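(* Let $M$ be a compact rotational constant mean curvature hypersurface of $\mathbb{S}^{n+1}$ generated by data $(n,H,c,r,\theta,l,m)$ as described in the context, so that $M$ is $\mathbb{S}^{n-1}\times(\mathbb{R}/mT\mathbb{Z})$ with the metric induced by the immersion $\phi$. Let $\bar f:\mathbb{S}^{n-1}\to\mathbb{R}$ be a smooth function and define $f:M\to\mathbb{R}$ by $f(y,t)=\bar f(y)$. Let $\bar g:\mathbb{R}\to\mathbb{R}$ be a smooth $mT$-periodic function and define $g:M\to\mathbb{R}$ by $g(y,t)=\bar g(t)$. Let $\Delta$ be the Laplacian of $M$ and $\bar\Delta$ the Laplacian of the round unit sphere $\mathbb{S}^{n-1}$. Then, at every $(y,t)\in M$, $$\Delta(fg)=f\left(\bar g''+(n-1)\frac{r'}{r}\,\bar g'\right)+\frac{\bar\Delta(\bar f)}{r^2}\,g .$$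
   Context: Rotational CMC hypersurfaces of the unit sphere $\mathbb{S}^{n+1}\subset\mathbb{R}^{n+2}$, $n\ge 2$. Fix $H\in\mathbb{R}$ and $c>0$. Let $r:\mathbb{R}\to(0,1)$ be a smooth non-constant periodic function with least period $T>0$ satisfying $$(r')^2+r^2(1+\lambda^2)=1,\qquad \lambda(t)=H+c^{-n/2}r(t)^{-n}.$$ Put $$\theta(t)=\int_0^t\frac{r(\tau)\lambda(\tau)}{1-r(\tau)^2}\,d\tau,$$ and assume that $c$ is such that $\theta(T)=2\pi\frac{l}{m}$ with $l,m$ relatively prime integers, $m\geq 1$. The immersion is $$\phi:\mathbb{S}^{n-1}\times\mathbb{R}\to\mathbb{S}^{n+1},\qquad \phi(y,t)=\left(r(t)\,y,\ \sqrt{1-r(t)^2}\cos\theta(t),\ \sqrt{1-r(t)^2}\sin\theta(t)\right).$$ It satisfies $\phi(y,t+mT)=\phi(y,t)$. The compact rotational hypersurface $M$ is the compact manifold $\mathbb{S}^{n-1}\times(\mathbb{R}/mT\mathbb{Z})$ immersed by $\phi$, with the induced metric; it has constant mean curvature $H$. The Laplacian is taken with the sign convention $\Delta=\mathrm{div}\,\nabla$. *)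

theory Defs
  imports "HOL-Analysis.Analysis"
begin

section \<open>Smooth maps\<close>

primrec higher_differentiable_on ::
    "'a::real_normed_vector set \<Rightarrow> ('a \<Rightarrow> 'b::real_normed_vector) \<Rightarrow> nat \<Rightarrow> bool" where
  "higher_differentiable_on U f 0 \<longleftrightarrow> continuous_on U f"
| "higher_differentiable_on U f (Suc k) \<longleftrightarrow>
     (\<forall>x\<in>U. f differentiable (at x)) \<and>
     (\<forall>v. higher_differentiable_on U (\<lambda>x. frechet_derivative f (at x) v) k)"

text \<open>Class $C^\infty$; only used for open sets.\<close>

definition smooth_on ::
    "'a::real_normed_vector set \<Rightarrow> ('a \<Rightarrow> 'b::real_normed_vector) \<Rightarrow> bool" where
  "smooth_on U f \<longleftrightarrow> (\<forall>k. higher_differentiable_on U f k)"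


section \<open>Riemannian metrics on open sets of a Euclidean space\<close>

text \<open>
  A metric is a function of a base point and two vectors.  On an open subset of a Euclidean space
  vector fields are functions, and the constant fields commute.
\<close>

type_synonym 'e metric = "'e \<Rightarrow> 'e \<Rightarrow> 'e \<Rightarrow> real"

definition induced_metric :: "('e::euclidean_space \<Rightarrow> 'a::euclidean_space) \<Rightarrow> 'e metric" where
  "induced_metric X a v w = frechet_derivative X (at a) v \<bullet> frechet_derivative X (at a) w"

definition gradient :: "'e::euclidean_space metric \<Rightarrow> ('e \<Rightarrow> real) \<Rightarrow> 'e \<Rightarrow> 'e" where
  "gradient G u a = (THE w. \<forall>v. G a w v = frechet_derivative u (at a) v)"

text \<open>
  The value at \<open>a\<close> of the Levi-Civita derivative of the constant field \<open>w\<close> in the direction \<open>v\<close>,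
  given by the Koszul formula for constant fields, in which the bracket terms vanish.  In components
  these are the Christoffel symbols.
\<close>

definition christoffel :: "'e::euclidean_space metric \<Rightarrow> 'e \<Rightarrow> 'e \<Rightarrow> 'e \<Rightarrow> 'e" where
  "christoffel G a v w = (THE z. \<forall>e. 2 * G a z e =
       frechet_derivative (\<lambda>b. G b w e) (at a) v
     + frechet_derivative (\<lambda>b. G b v e) (at a) w
     - frechet_derivative (\<lambda>b. G b v w) (at a) e)"

definition levi_civita ::
    "'e::euclidean_space metric \<Rightarrow> ('e \<Rightarrow> 'e) \<Rightarrow> 'e \<Rightarrow> 'e \<Rightarrow> 'e" where
  "levi_civita G V a v = frechet_derivative V (at a) v + christoffel G a v (V a)"

text \<open>
  The divergence of \<open>V\<close> is the trace of the endomorphism \<open>v \<mapsto> \<nabla>\<^sub>v V\<close>.  A trace does not depend on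
  the basis, so the standard one is used and the metric does not enter its computation.
\<close>

definition divergence :: "'e::euclidean_space metric \<Rightarrow> ('e \<Rightarrow> 'e) \<Rightarrow> 'e \<Rightarrow> real" where
  "divergence G V a = (\<Sum>b\<in>Basis. levi_civita G V a b \<bullet> b)"

definition metric_laplacian :: "'e::euclidean_space metric \<Rightarrow> ('e \<Rightarrow> real) \<Rightarrow> 'e \<Rightarrow> real" where
  "metric_laplacian G u = divergence G (gradient G u)"


section \<open>Manifolds given by local parametrizations\<close>

text \<open>
  An atlas on a set of points of type \<open>'m\<close> is a set of pairs \<open>(U, x)\<close> of an open set \<open>U\<close> of the model
  space and a local parametrization \<open>x\<close> with domain \<open>U\<close> (the inverse of a coordinate chart).
\<close>

type_synonym ('e, 'm) atlas = "('e set \<times> ('e \<Rightarrow> 'm)) set"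

text \<open>
  All local parametrizations of a submanifold \<open>S\<close> of a Euclidean space whose dimension is that of
  the model space \<open>'e\<close>.
\<close>

definition submanifold_atlas ::
    "'e::euclidean_space itself \<Rightarrow> 'a::euclidean_space set \<Rightarrow> ('e, 'a) atlas" where
  "submanifold_atlas _ S = {(U, x). open U \<and> smooth_on U x \<and>
      (\<forall>a\<in>U. inj (frechet_derivative x (at a))) \<and>
      openin (top_of_set S) (x ` U) \<and> (\<exists>x'. homeomorphism U (x ` U) x x')}"

definition smooth_function ::
    "('e::euclidean_space, 'm) atlas \<Rightarrow> ('m \<Rightarrow> real) \<Rightarrow> bool" where
  "smooth_function A f \<longleftrightarrow> (\<forall>(U, x)\<in>A. smooth_on U (f \<circ> x))"

text \<open>
  The Laplacian at the point \<open>p\<close> of the manifold with atlas \<open>A\<close> and the metric induced by the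
  immersion \<open>F\<close>: the common value obtained in all local parametrizations around \<open>p\<close>.
\<close>

definition laplacian ::
    "('e::euclidean_space, 'm) atlas \<Rightarrow> ('m \<Rightarrow> 'a::euclidean_space) \<Rightarrow> ('m \<Rightarrow> real) \<Rightarrow> 'm \<Rightarrow> real"
  where
  "laplacian A F u p = (THE L. \<forall>(U, x)\<in>A. \<forall>a\<in>U. x a = p \<longrightarrow>
      metric_laplacian (induced_metric (F \<circ> x)) (u \<circ> x) a = L)"


section \<open>Rotational hypersurfaces\<close>

definition least_period :: "(real \<Rightarrow> 'b) \<Rightarrow> real \<Rightarrow> bool" where
  "least_period r T \<longleftrightarrow> T > 0 \<and> (\<forall>t. r (t + T) = r t) \<and>
     (\<forall>S. 0 < S \<and> S < T \<longrightarrow> (\<exists>t. r (t + S) \<noteq> r t))"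

definition curv :: "nat \<Rightarrow> real \<Rightarrow> real \<Rightarrow> (real \<Rightarrow> real) \<Rightarrow> real \<Rightarrow> real" where
  "curv n H c r t = H + c powr (- (real n / 2)) * r t powr (- real n)"

definition angle :: "nat \<Rightarrow> real \<Rightarrow> real \<Rightarrow> (real \<Rightarrow> real) \<Rightarrow> real \<Rightarrow> real" where
  "angle n H c r t = (LBINT \<tau>=0..t. r \<tau> * curv n H c r \<tau> / (1 - (r \<tau>)\<^sup>2))"

definition rot_immersion ::
    "nat \<Rightarrow> real \<Rightarrow> real \<Rightarrow> (real \<Rightarrow> real) \<Rightarrow> 'a::euclidean_space \<times> real \<Rightarrow> 'a \<times> real \<times> real" where
  "rot_immersion n H c r = (\<lambda>(y, t).
     (r t *\<^sub>R y,
      sqrt (1 - (r t)\<^sup>2) * cos (angle n H c r t),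
      sqrt (1 - (r t)\<^sup>2) * sin (angle n H c r t)))"

text \<open>
  The elements of \<open>\<real> / P\<int>\<close> are the classes \<open>period_rel P `` {t}\<close>.
\<close>

definition period_rel :: "real \<Rightarrow> (real \<times> real) set" where
  "period_rel P = {(s, t). \<exists>k::int. t = s + of_int k * P}"

definition rot_point :: "real \<Rightarrow> 'a \<times> real \<Rightarrow> 'a \<times> real set" where
  "rot_point P = (\<lambda>(y, t). (y, period_rel P `` {t}))"

text \<open>
  The smooth structure of the product of the unit sphere of \<open>'a\<close> with \<open>\<real> / P\<int>\<close>: the
  parametrizations are those of the product of the sphere with the real line whose composition with
  the covering map \<open>rot_point P\<close> is still injective.
\<close>

definition rot_atlas :: "real \<Rightarrow> ('a, 'a::euclidean_space \<times> real set) atlas" where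
  "rot_atlas P = {(U, rot_point P \<circ> x) | U x.
      (U, x) \<in> submanifold_atlas TYPE('a) (sphere 0 1 \<times> UNIV) \<and> inj_on (rot_point P \<circ> x) U}"

text \<open>
  The immersion on the quotient.  For a \<open>P\<close>-periodic immersion the image of each class is a
  singleton.
\<close>

definition rot_quotient_immersion ::
    "nat \<Rightarrow> real \<Rightarrow> real \<Rightarrow> (real \<Rightarrow> real) \<Rightarrow> 'a::euclidean_space \<times> real set \<Rightarrow> 'a \<times> real \<times> real" where
  "rot_quotient_immersion n H c r = (\<lambda>(y, C). the_elem ((\<lambda>t. rot_immersion n H c r (y, t)) ` C))"

end

theory Submission
  imports Defs
begin

text \<open>
  In a parametrization \<open>(Y, \<tau>)\<close> of \<open>S\<^sup>n\<^sup>-\<^sup>1 \<times> \<real>\<close> the metric induced by the rotational immersion is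
  the warped product \<open>r(\<tau>)\<^sup>2 \<langle>dY, dY\<rangle> + d\<tau>\<^sup>2\<close>: the equation satisfied by \<open>r\<close> says precisely that the
  profile curve has unit speed (\<open>profile_curve_unit_speed\<close>, \<open>induced_metric_warped\<close>).  For such a
  metric the formula is the classical one: the Laplacian of the sphere is rescaled by \<open>1 / r\<^sup>2\<close>, and
  the growth of the spheres \<open>\<tau> = const\<close>, of dimension \<open>n - 1\<close>, contributes the drift
  \<open>(n - 1) (r' / r) \<partial>\<^sub>\<tau>\<close>.

  A Laplacian of a manifold is defined as the common value in all parametrizations around a point, so
  this common value has to be exhibited.  Changes of coordinates are avoided by computing in an
  arbitrary parametrization and arriving at an expression that does not mention it.  The tool is
  \<open>metric_laplacian_eq_trace_hessian\<close>: the coordinate Laplacian at \<open>a\<close> is the sum of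
  \<open>D\<^sup>2u(v, v) - Du(\<Gamma>(v, v))\<close> over any basis \<open>v\<close> that is orthonormal for the metric at \<open>a\<close>.  It needs
  nothing about Christoffel symbols except their values \<open>\<Gamma>(v, v)\<close>, which the Koszul formula gives.

  Fix \<open>y\<close> on the sphere and identify \<open>y\<^sup>\<bottom>\<close> with \<open>\<real>\<^sup>n\<^sup>-\<^sup>1\<close> by an isometry \<open>\<iota>\<close>.  The hemisphere around
  \<open>y\<close> is the graph of \<open>z \<mapsto> \<iota> z + sqrt (1 - |z|\<^sup>2) y\<close> over the unit ball, whose inverse is the linear
  map \<open>proj\<close>, the adjoint of \<open>\<iota>\<close>.  Hence in any parametrization \<open>Y\<close> the function \<open>fbar \<circ> Y\<close> is
  \<open>h \<circ> proj \<circ> Y\<close> with \<open>h\<close> the expression of \<open>fbar\<close> in the graph chart.  The graph coordinates have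
  vanishing Hessian at \<open>y\<close>, so the Laplacian of \<open>fbar\<close> at \<open>y\<close> is the Euclidean Laplacian of \<open>h\<close> at
  \<open>0\<close> (\<open>sphere_laplacian_graph_chart\<close>).  The same coordinates on the warped product have Hessian
  \<open>- 2 (r' / r) d\<tau> dz\<close>, which has no diagonal entries in an adapted orthonormal basis, and \<open>\<tau>\<close> has
  Hessian \<open>r r' |dz|\<^sup>2\<close>, whose trace is \<open>(n - 1) r' / r\<close>; the product rule for Hessians then yields the
  theorem (\<open>warped_laplacian_graph_chart\<close>).
\<close>

section \<open>Directional derivatives and second derivatives\<close>

text \<open>
  The point is the last argument, so that second derivatives are iterated ones, \<open>dd w (dd v f)\<close>, as in
  the notion of smoothness used here.
\<close>

abbreviation dd :: "'a::real_normed_vector \<Rightarrow> ('a \<Rightarrow> 'b::real_normed_vector) \<Rightarrow> 'a \<Rightarrow> 'b" where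
  "dd v f x \<equiv> frechet_derivative f (at x) v"

lemma dd_eq: "(f has_derivative F) (at x) \<Longrightarrow> dd v f x = F v"
  by (metis frechet_derivative_at)

lemma linear_dd: "f differentiable at x \<Longrightarrow> linear (\<lambda>v. dd v f x)"
  by (simp add: linear_frechet_derivative)

lemma dd_works: "f differentiable at x \<Longrightarrow> (f has_derivative (\<lambda>v. dd v f x)) (at x)"
  by (simp add: frechet_derivative_works)

lemma dd_cong_open:
  assumes "open S" "x \<in> S" "\<And>y. y \<in> S \<Longrightarrow> f y = g y"
  shows "dd v f x = dd v g x"
proof -
  have "(f has_derivative F) (at x) \<longleftrightarrow> (g has_derivative F) (at x)" for F
    using has_derivative_transform_within_open[OF _ assms(1,2), of f F UNIV g]
      has_derivative_transform_within_open[OF _ assms(1,2), of g F UNIV f] assms(3) by auto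
  then show ?thesis by (simp add: frechet_derivative_def)
qed

lemma differentiable_cong_open:
  assumes "open S" "x \<in> S" "\<And>y. y \<in> S \<Longrightarrow> f y = g y" "f differentiable at x"
  shows "g differentiable at x"
  using assms unfolding differentiable_def
  by (meson has_derivative_transform_within_open)

lemma higher_diff_mono_on:
  "higher_differentiable_on U f k \<Longrightarrow> V \<subseteq> U \<Longrightarrow> higher_differentiable_on V f k"
  by (induction k arbitrary: f) (auto intro: continuous_on_subset)

lemma higher_diff_cong:
  assumes "open U" "\<And>x. x \<in> U \<Longrightarrow> f x = g x" "higher_differentiable_on U f k"
  shows "higher_differentiable_on U g k"
  using assms(2,3)
proof (induction k arbitrary: f g)
  case 0
  then show ?case by (simp cong: continuous_on_cong)
next
  case (Suc k)
  have "dd v f x = dd v g x" if "x \<in> U" for x v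
    by (rule dd_cong_open[OF assms(1) that]) (use Suc in auto)
  then have "higher_differentiable_on U (dd v g) k" for v
    using Suc.IH[of "dd v f" "dd v g"] Suc.prems by auto
  moreover have "g differentiable at x" if "x \<in> U" for x
    by (rule differentiable_cong_open[OF assms(1) that, of f]) (use Suc.prems that in auto)
  ultimately show ?case by simp
qed

lemma higher_diff_Suc_imp: "higher_differentiable_on U f (Suc k) \<Longrightarrow> higher_differentiable_on U f k"
proof (induction k arbitrary: f)
  case 0
  then show ?case
    by (auto intro!: continuous_at_imp_continuous_on differentiable_imp_continuous_within)
qed auto

lemma higher_diff_2D:
  assumes "higher_differentiable_on U f 2"
  shows "x \<in> U \<Longrightarrow> f differentiable at x" "x \<in> U \<Longrightarrow> dd v f differentiable at x"
    "continuous_on U (dd w (dd v f))"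
  using assms by (auto simp: numeral_2_eq_2)

lemma smooth_onD: "smooth_on U f \<Longrightarrow> higher_differentiable_on U f k"
  by (simp add: smooth_on_def)

text \<open>
  Two applications of the mean value theorem, along \<open>v\<close> and then along \<open>w\<close>, turn the second
  difference into an iterated derivative.  The left-hand side is symmetric in \<open>v\<close> and \<open>w\<close>, which is the
  source of the symmetry of second derivatives.
\<close>

lemma second_difference_mvt:
  fixes f :: "'a::real_normed_vector \<Rightarrow> real"
  assumes d: "\<And>x. x \<in> ball a \<delta> \<Longrightarrow> f differentiable at x"
      "\<And>x. x \<in> ball a \<delta> \<Longrightarrow> dd v f differentiable at x"
    and s: "s > 0" "s * (norm v + norm w) < \<delta>"
  obtains x where "norm (x - a) \<le> s * (norm v + norm w)"
    "f (a + s *\<^sub>R v + s *\<^sub>R w) - f (a + s *\<^sub>R v) - f (a + s *\<^sub>R w) + f a = s * s * dd w (dd v f) x"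
proof -
  have nb: "norm (\<tau> *\<^sub>R v + \<sigma> *\<^sub>R w) \<le> s * (norm v + norm w)"
    if "0 \<le> \<tau>" "\<tau> \<le> s" "0 \<le> \<sigma>" "\<sigma> \<le> s" for \<tau> \<sigma>
  proof -
    have "norm (\<tau> *\<^sub>R v + \<sigma> *\<^sub>R w) \<le> \<tau> * norm v + \<sigma> * norm w"
      using norm_triangle_ineq[of "\<tau> *\<^sub>R v" "\<sigma> *\<^sub>R w"] that by simp
    also have "\<dots> \<le> s * norm v + s * norm w"
      using that by (intro add_mono mult_right_mono) auto
    finally show ?thesis by (simp add: algebra_simps)
  qed
  have inb: "a + \<tau> *\<^sub>R v + \<sigma> *\<^sub>R w \<in> ball a \<delta>"
    if "0 \<le> \<tau>" "\<tau> \<le> s" "0 \<le> \<sigma>" "\<sigma> \<le> s" for \<tau> \<sigma>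
  proof -
    have "dist (a + \<tau> *\<^sub>R v + \<sigma> *\<^sub>R w) a = norm (\<tau> *\<^sub>R v + \<sigma> *\<^sub>R w)"
      by (simp add: dist_norm add.assoc)
    then show ?thesis using nb[OF that] s(2) by (simp add: dist_commute)
  qed
  have der: "((\<lambda>\<tau>. g (p + \<tau> *\<^sub>R u)) has_real_derivative dd u g (p + \<tau> *\<^sub>R u)) (at \<tau>)"
    if "g differentiable at (p + \<tau> *\<^sub>R u)" for g :: "'a \<Rightarrow> real" and p u \<tau>
  proof -
    have "((\<lambda>\<tau>. p + \<tau> *\<^sub>R u) has_derivative (\<lambda>t. t *\<^sub>R u)) (at \<tau>)"
      by (auto intro!: derivative_eq_intros)
    from diff_chain_at[OF this dd_works[OF that]]
    have "((\<lambda>\<tau>. g (p + \<tau> *\<^sub>R u)) has_derivative (\<lambda>t. dd (t *\<^sub>R u) g (p + \<tau> *\<^sub>R u))) (at \<tau>)"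
      by (simp add: o_def)
    then show ?thesis
      by (simp add: has_field_derivative_def linear_scale[OF linear_dd[OF that]] mult.commute[of _ "dd u g _"])
  qed
  have "\<exists>\<xi>>0. \<xi> < s \<and> (f (a + s *\<^sub>R w + s *\<^sub>R v) - f (a + s *\<^sub>R v)) - (f (a + s *\<^sub>R w + 0 *\<^sub>R v) - f (a + 0 *\<^sub>R v))
      = (s - 0) * (dd v f (a + s *\<^sub>R w + \<xi> *\<^sub>R v) - dd v f (a + \<xi> *\<^sub>R v))"
    using s(1)
  proof (rule MVT2)
    fix \<tau> assume "0 \<le> \<tau>" "\<tau> \<le> s"
    then have "f differentiable at (a + s *\<^sub>R w + \<tau> *\<^sub>R v)" "f differentiable at (a + \<tau> *\<^sub>R v)"
      using d(1)[OF inb[of \<tau> s]] d(1)[OF inb[of \<tau> 0]] s(1) by (auto simp: algebra_simps)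
    then show "((\<lambda>\<tau>. f (a + s *\<^sub>R w + \<tau> *\<^sub>R v) - f (a + \<tau> *\<^sub>R v)) has_real_derivative
        (dd v f (a + s *\<^sub>R w + \<tau> *\<^sub>R v) - dd v f (a + \<tau> *\<^sub>R v))) (at \<tau>)"
      by (intro DERIV_diff der)
  qed
  then obtain \<xi> where \<xi>: "0 < \<xi>" "\<xi> < s"
    and e1: "f (a + s *\<^sub>R w + s *\<^sub>R v) - f (a + s *\<^sub>R v) - (f (a + s *\<^sub>R w) - f a)
      = s * (dd v f (a + s *\<^sub>R w + \<xi> *\<^sub>R v) - dd v f (a + \<xi> *\<^sub>R v))" by auto
  have "\<exists>\<eta>>0. \<eta> < s \<and> dd v f (a + \<xi> *\<^sub>R v + s *\<^sub>R w) - dd v f (a + \<xi> *\<^sub>R v + 0 *\<^sub>R w)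
      = (s - 0) * dd w (dd v f) (a + \<xi> *\<^sub>R v + \<eta> *\<^sub>R w)"
    using s(1) by (rule MVT2) (use \<xi> in \<open>auto intro!: der d inb\<close>)
  then obtain \<eta> where \<eta>: "0 < \<eta>" "\<eta> < s"
    and e2: "dd v f (a + \<xi> *\<^sub>R v + s *\<^sub>R w) - dd v f (a + \<xi> *\<^sub>R v)
      = s * dd w (dd v f) (a + \<xi> *\<^sub>R v + \<eta> *\<^sub>R w)" by auto
  show thesis
  proof (rule that)
    show "norm (a + \<xi> *\<^sub>R v + \<eta> *\<^sub>R w - a) \<le> s * (norm v + norm w)"
      using nb[of \<xi> \<eta>] \<xi> \<eta> by (simp add: add.assoc)
    have "a + s *\<^sub>R w + \<xi> *\<^sub>R v = a + \<xi> *\<^sub>R v + s *\<^sub>R w"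
        "a + s *\<^sub>R w + s *\<^sub>R v = a + s *\<^sub>R v + s *\<^sub>R w" by (simp_all add: algebra_simps)
    then show "f (a + s *\<^sub>R v + s *\<^sub>R w) - f (a + s *\<^sub>R v) - f (a + s *\<^sub>R w) + f a
        = s * s * dd w (dd v f) (a + \<xi> *\<^sub>R v + \<eta> *\<^sub>R w)"
      using e1 e2 by (simp add: algebra_simps)
  qed
qed

text \<open>
  Schwarz's theorem: if the two iterated derivatives differed at \<open>a\<close>, continuity would keep them apart
  near \<open>a\<close>, while both equal the same second difference at points arbitrarily close to \<open>a\<close>.
\<close>

lemma mixed_derivatives_real:
  fixes f :: "'a::real_normed_vector \<Rightarrow> real"
  assumes f: "higher_differentiable_on U f 2" and U: "open U" "a \<in> U"
  shows "dd w (dd v f) a = dd v (dd w f) a"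
proof (rule ccontr)
  define \<epsilon> where "\<epsilon> = \<bar>dd w (dd v f) a - dd v (dd w f) a\<bar> / 2"
  assume "dd w (dd v f) a \<noteq> dd v (dd w f) a"
  then have \<epsilon>: "\<epsilon> > 0" by (simp add: \<epsilon>_def)
  have "isCont (dd w (dd v f)) a" for v w
    using higher_diff_2D(3)[OF f, of v w] U(2) unfolding continuous_on_eq_continuous_at[OF U(1)] by (rule bspec)
  then have "(dd w (dd v f) \<longlongrightarrow> dd w (dd v f) a) (nhds a)" for v w
    using tendsto_at_iff_tendsto_nhds[of "dd w (dd v f)" a] unfolding continuous_at by (rule rev_iffD1)
  then have "\<forall>\<^sub>F x in nhds a. dist (dd w (dd v f) x) (dd w (dd v f) a) < \<epsilon> \<and>
       dist (dd v (dd w f) x) (dd v (dd w f) a) < \<epsilon> \<and> x \<in> U"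
    using \<epsilon> by (intro eventually_conj tendstoD eventually_nhds_in_open U)
       auto
  then obtain \<delta> where \<delta>: "\<delta> > 0" and near: "\<And>x. dist x a < \<delta> \<Longrightarrow> dist (dd w (dd v f) x) (dd w (dd v f) a) < \<epsilon> \<and>
       dist (dd v (dd w f) x) (dd v (dd w f) a) < \<epsilon> \<and> x \<in> U"
    unfolding eventually_nhds_metric by blast
  \<comment> \<open>The summand 1 keeps the quotient meaningful and the bound strict even for \<open>v = w = 0\<close>.\<close>
  define s where "s = \<delta> / (norm v + norm w + 1)"
  have pos: "norm v + norm w + 1 > 0" by (smt (verit) norm_ge_zero)
  have s: "s > 0" "s * (norm v + norm w) < \<delta>"
    using \<delta> pos by (auto simp: s_def field_simps)
  have dif: "f differentiable at x" "dd z f differentiable at x" if "x \<in> ball a \<delta>" for x z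
    using higher_diff_2D(1,2)[OF f] near[of x] that by (auto simp: dist_commute)
  obtain x where x: "norm (x - a) \<le> s * (norm v + norm w)"
    "f (a + s *\<^sub>R v + s *\<^sub>R w) - f (a + s *\<^sub>R v) - f (a + s *\<^sub>R w) + f a = s * s * dd w (dd v f) x"
    by (rule second_difference_mvt[of a \<delta> f v s w]) (use dif s in auto)
  obtain y where y: "norm (y - a) \<le> s * (norm w + norm v)"
    "f (a + s *\<^sub>R w + s *\<^sub>R v) - f (a + s *\<^sub>R w) - f (a + s *\<^sub>R v) + f a = s * s * dd v (dd w f) y"
    by (rule second_difference_mvt[of a \<delta> f w s v]) (use dif s in \<open>auto simp: add.commute\<close>)
  have "a + s *\<^sub>R w + s *\<^sub>R v = a + s *\<^sub>R v + s *\<^sub>R w" by (simp add: algebra_simps)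
  with y(2) have "f (a + s *\<^sub>R v + s *\<^sub>R w) - f (a + s *\<^sub>R w) - f (a + s *\<^sub>R v) + f a = s * s * dd v (dd w f) y" by (simp only:)
  with x(2) have "s * s * dd w (dd v f) x = s * s * dd v (dd w f) y" by linarith
  then have eq: "dd w (dd v f) x = dd v (dd w f) y" using s by simp
  have "dist x a < \<delta>" "dist y a < \<delta>" using x(1) y(1) s(2) by (auto simp: dist_norm add.commute)
  with near have "\<bar>dd w (dd v f) x - dd w (dd v f) a\<bar> < \<epsilon>" "\<bar>dd v (dd w f) y - dd v (dd w f) a\<bar> < \<epsilon>"
    unfolding dist_real_def by blast+
  moreover have "2 * \<epsilon> = \<bar>dd w (dd v f) a - dd v (dd w f) a\<bar>" by (simp add: \<epsilon>_def)
  ultimately show False using eq by linarith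
qed

lemma dd_inner:
  assumes "f differentiable at x"
  shows "dd v (\<lambda>x. f x \<bullet> i) x = dd v f x \<bullet> i"
  by (rule dd_eq) (use dd_works[OF assms] in \<open>auto intro!: derivative_eq_intros\<close>)

lemma higher_diff_inner:
  assumes "open U" "higher_differentiable_on U f k"
  shows "higher_differentiable_on U (\<lambda>x. f x \<bullet> i) k"
  using assms(2)
proof (induction k arbitrary: f)
  case 0
  then show ?case by (auto intro: continuous_intros)
next
  case (Suc k)
  have "higher_differentiable_on U (dd v (\<lambda>x. f x \<bullet> i)) k" for v
    by (rule higher_diff_cong[OF assms(1) _ Suc.IH[of "dd v f"]]) (use Suc.prems in \<open>auto simp: dd_inner\<close>)
  then show ?case using Suc by (auto intro: differentiable_inner)
qed

lemma mixed_derivatives: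
  fixes f :: "'a::real_normed_vector \<Rightarrow> 'b::euclidean_space"
  assumes f: "higher_differentiable_on U f 2" and U: "open U" "a \<in> U"
  shows "dd w (dd v f) a = dd v (dd w f) a"
proof (rule euclidean_eqI)
  fix i :: 'b
  have *: "dd w (dd v (\<lambda>x. f x \<bullet> i)) a = dd w (dd v f) a \<bullet> i" for v w
  proof -
    have "dd w (dd v (\<lambda>x. f x \<bullet> i)) a = dd w (\<lambda>x. dd v f x \<bullet> i) a"
      by (rule dd_cong_open[OF U]) (simp add: dd_inner higher_diff_2D(1)[OF f])
    then show ?thesis using dd_inner higher_diff_2D(2)[OF f U(2)] by metis
  qed
  show "dd w (dd v f) a \<bullet> i = dd v (dd w f) a \<bullet> i"
    using mixed_derivatives_real[OF higher_diff_inner[OF U(1) f] U] * by metis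
qed

lemma dd_Basis_sum:
  fixes f :: "'a::euclidean_space \<Rightarrow> 'b::real_normed_vector"
  assumes "f differentiable at x"
  shows "dd v f x = (\<Sum>i\<in>Basis. (v \<bullet> i) *\<^sub>R dd i f x)"
proof -
  have "dd v f x = dd (\<Sum>i\<in>Basis. (v \<bullet> i) *\<^sub>R i) f x" by (simp add: euclidean_representation)
  also have "\<dots> = (\<Sum>i\<in>Basis. (v \<bullet> i) *\<^sub>R dd i f x)"
    using linear_dd[OF assms] by (simp add: linear_sum linear_scale)
  finally show ?thesis .
qed

lemma second_derivative_Basis_sum:
  fixes f :: "'a::euclidean_space \<Rightarrow> 'b::real_normed_vector"
  assumes "higher_differentiable_on U f 2" "open U" "x \<in> U"
  shows "dd w (dd v f) x = (\<Sum>i\<in>Basis. (v \<bullet> i) *\<^sub>R dd w (dd i f) x)"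
proof -
  have "dd w (dd v f) x = dd w (\<lambda>x. \<Sum>i\<in>Basis. (v \<bullet> i) *\<^sub>R dd i f x) x"
    by (rule dd_cong_open[OF assms(2,3)]) (rule dd_Basis_sum[OF higher_diff_2D(1)[OF assms(1)]])
  also have "\<dots> = (\<Sum>i\<in>Basis. (v \<bullet> i) *\<^sub>R dd w (dd i f) x)"
    by (rule dd_eq) (use dd_works[OF higher_diff_2D(2)[OF assms(1,3)]] in \<open>auto intro!: derivative_eq_intros\<close>)
  finally show ?thesis .
qed

lemma dd_compose:
  assumes "z differentiable at x" "h differentiable at (z x)"
  shows "dd v (\<lambda>x. h (z x)) x = dd (dd v z x) h (z x)"
    "(\<lambda>x. h (z x)) differentiable at x"
proof -
  have *: "((\<lambda>x. h (z x)) has_derivative (\<lambda>v. dd (dd v z x) h (z x))) (at x)"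
    using diff_chain_at[OF dd_works[OF assms(1)] dd_works[OF assms(2)]] by (simp add: o_def)
  from dd_eq[OF *] show "dd v (\<lambda>x. h (z x)) x = dd (dd v z x) h (z x)" .
  from * show "(\<lambda>x. h (z x)) differentiable at x" by (auto simp: differentiable_def)
qed

text \<open>
  The direction \<open>dd v z b\<close> in which \<open>h\<close> is differentiated varies with \<open>b\<close>.  Expanding it in the standard
  basis leaves derivatives of \<open>h\<close> in constant directions, to which the product rule applies.
\<close>

lemma second_derivative_compose:
  fixes h :: "'d::euclidean_space \<Rightarrow> real" and z :: "'e::real_normed_vector \<Rightarrow> 'd"
  assumes h: "higher_differentiable_on V h 2" "open V"
    and z: "higher_differentiable_on U z 2" "open U" and V: "z ` U \<subseteq> V" and a: "a \<in> U"
  shows "dd w (dd v (\<lambda>x. h (z x))) a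
      = dd (dd w z a) (dd (dd v z a) h) (z a) + dd (dd w (dd v z) a) h (z a)"
    and "dd v (\<lambda>x. h (z x)) differentiable at a"
proof -
  have zV: "z x \<in> V" if "x \<in> U" for x using V that by auto
  have eq: "(\<Sum>i\<in>Basis. (dd v z b \<bullet> i) * dd i h (z b)) = dd v (\<lambda>x. h (z x)) b" if "b \<in> U" for b
    using dd_compose(1)[OF higher_diff_2D(1)[OF z(1) that] higher_diff_2D(1)[OF h(1) zV[OF that]]]
      dd_Basis_sum[OF higher_diff_2D(1)[OF h(1) zV[OF that]]] by (metis (no_types, lifting) real_scaleR_def sum.cong)
  have "((\<lambda>b. \<Sum>i\<in>Basis. (dd v z b \<bullet> i) * dd i h (z b)) has_derivative
     (\<lambda>w. \<Sum>i\<in>Basis. (dd v z a \<bullet> i) * dd (dd w z a) (dd i h) (z a) + (dd w (dd v z) a \<bullet> i) * dd i h (z a))) (at a)"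
  proof (rule has_derivative_sum)
    fix i :: 'd
    have 1: "((\<lambda>b. dd i h (z b)) has_derivative (\<lambda>w. dd (dd w z a) (dd i h) (z a))) (at a)"
      using diff_chain_at[OF dd_works[OF higher_diff_2D(1)[OF z(1) a]] dd_works[OF higher_diff_2D(2)[OF h(1) zV[OF a]]]]
      by (simp add: o_def)
    have 2: "((\<lambda>b. dd v z b \<bullet> i) has_derivative (\<lambda>w. dd w (dd v z) a \<bullet> i)) (at a)"
      using dd_works[OF higher_diff_2D(2)[OF z(1) a]] by (auto intro!: derivative_eq_intros)
    show "((\<lambda>b. (dd v z b \<bullet> i) * dd i h (z b)) has_derivative
      (\<lambda>w. (dd v z a \<bullet> i) * dd (dd w z a) (dd i h) (z a) + (dd w (dd v z) a \<bullet> i) * dd i h (z a))) (at a)"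
      using has_derivative_mult[OF 2 1] .
  qed
  then have *: "(dd v (\<lambda>x. h (z x)) has_derivative
     (\<lambda>w. \<Sum>i\<in>Basis. (dd v z a \<bullet> i) * dd (dd w z a) (dd i h) (z a) + (dd w (dd v z) a \<bullet> i) * dd i h (z a))) (at a)"
    by (rule has_derivative_transform_within_open[OF _ z(2) a]) (rule eq)
  then show "dd v (\<lambda>x. h (z x)) differentiable at a" by (auto simp: differentiable_def)
  show "dd w (dd v (\<lambda>x. h (z x))) a
      = dd (dd w z a) (dd (dd v z a) h) (z a) + dd (dd w (dd v z) a) h (z a)"
    unfolding dd_eq[OF *] second_derivative_Basis_sum[OF h zV[OF a], where v = "dd v z a"]
      dd_Basis_sum[OF higher_diff_2D(1)[OF h(1) zV[OF a]], where v = "dd w (dd v z) a"] by (simp add: sum.distrib)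
qed

section \<open>The Laplacian as a trace of the Hessian\<close>

lemma linear_trace_commute:
  fixes M :: "'d::euclidean_space \<Rightarrow> 'e::euclidean_space"
  assumes "linear M" "linear N"
  shows "(\<Sum>b\<in>Basis. M (N b) \<bullet> b) = (\<Sum>i\<in>Basis. N (M i) \<bullet> i)"
proof -
  have M: "M (N b) \<bullet> b = (\<Sum>i\<in>Basis. (N b \<bullet> i) * (M i \<bullet> b))" for b
    by (subst euclidean_representation[of "N b", symmetric])
       (simp add: linear_sum[OF assms(1)] linear_scale[OF assms(1)] inner_sum_left del: euclidean_representation)
  have N: "N (M i) \<bullet> i = (\<Sum>b\<in>Basis. (N b \<bullet> i) * (M i \<bullet> b))" for i
    by (subst euclidean_representation[of "M i", symmetric])
       (simp add: linear_sum[OF assms(2)] linear_scale[OF assms(2)] inner_sum_left mult.commute del: euclidean_representation)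
  show ?thesis unfolding M N by (rule sum.swap)
qed

locale inner_form =
  fixes B :: "'e::euclidean_space \<Rightarrow> 'e \<Rightarrow> real"
  assumes bilin: "bilinear B" and sym: "B v w = B w v" and pos: "v \<noteq> 0 \<Longrightarrow> B v v > 0"
begin

lemma lin: "linear (\<lambda>w. B w v)" "linear (B v)"
  using bilin by (auto simp: bilinear_def)

lemma nondegenerate: "(\<And>e. B v e = B w e) \<Longrightarrow> v = w"
  using pos[of "v - w"] linear_diff[OF lin(1), of v w "v - w"] by (metis cancel_comm_monoid_add_class.diff_cancel eq_iff_diff_eq_0 less_irrefl)

lemma riesz:
  assumes l: "linear l"
  obtains z where "\<And>e. B z e = l e"
proof -
  define F where "F w = (\<Sum>b\<in>Basis. B w b *\<^sub>R b)" for w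
  have F: "linear F"
    unfolding F_def by (intro linear_compose_sum ballI linear_compose[OF lin(1), unfolded o_def]
        linear_scaleR_left linear_compose_scale)
  have on_Basis: "B w = k" if "linear k" "\<And>b. b \<in> Basis \<Longrightarrow> F w \<bullet> b = k b" for w k
    by (rule linear_eq_stdbasis[OF lin(2) that(1)])
       (use that(2) in \<open>auto simp: F_def inner_sum_left_Basis\<close>)
  have "inj F"
    unfolding linear_injective_0[OF F]
  proof safe
    fix w assume "F w = 0"
    then have "B w = (\<lambda>_. 0)" by (intro on_Basis) (auto simp: module_hom_zero)
    then show "w = 0" using pos[of w] by auto
  qed
  then have "surj F" using linear_injective_imp_surjective[OF F] by blast
  then obtain z where "F z = (\<Sum>b\<in>Basis. l b *\<^sub>R b)" by (metis surjD)
  then have "B z = l" by (intro on_Basis l) (simp add: inner_sum_left_Basis)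
  then show thesis using that[of z] by simp
qed

lemma the_riesz:
  assumes "linear l"
  shows "B (THE z. \<forall>e. B z e = l e) e = l e"
proof -
  obtain z where z: "\<And>e. B z e = l e" using riesz[OF assms] by blast
  have "(THE z. \<forall>e. B z e = l e) = z"
    by (rule the_equality) (use z nondegenerate in auto)
  then show ?thesis using z by simp
qed

end

lemma differentiable_det:
  fixes M :: "'a::real_normed_vector \<Rightarrow> real ^ 'n ^ 'n"
  assumes "\<And>i j. (\<lambda>x. M x $ i $ j) differentiable at a"
  shows "(\<lambda>x. det (M x)) differentiable at a"
proof -
  have "(\<lambda>x. \<Prod>i\<in>UNIV. M x $ i $ p i) differentiable at a" for p
  proof -
    have "((\<lambda>x. M x $ i $ p i) has_derivative (\<lambda>v. dd v (\<lambda>x. M x $ i $ p i) a)) (at a)" for i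
      by (rule dd_works[OF assms])
    from has_derivative_prod[of UNIV "\<lambda>i x. M x $ i $ p i", OF this] show ?thesis
      unfolding differentiable_def by blast
  qed
  then show ?thesis
    unfolding det_def by (intro differentiable_sum differentiable_mult) auto
qed

locale local_metric =
  fixes S :: "(real ^ 'e) set" and G :: "(real ^ 'e) metric"
  assumes open_domain: "open S"
    and form: "b \<in> S \<Longrightarrow> inner_form (G b)"
    and diff_metric: "b \<in> S \<Longrightarrow> (\<lambda>b. G b v w) differentiable at b"
begin

definition dG :: "real ^ 'e \<Rightarrow> real ^ 'e \<Rightarrow> real ^ 'e \<Rightarrow> real ^ 'e \<Rightarrow> real" where
  "dG a v w e = dd v (\<lambda>b. G b w e) a"

lemma dG_sym: "a \<in> S \<Longrightarrow> dG a v w e = dG a v e w"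
  unfolding dG_def
  by (rule dd_cong_open[OF open_domain]) (auto simp: inner_form.sym[OF form])

lemma linear_dG: 
  assumes "a \<in> S"
  shows "linear (\<lambda>v. dG a v w e)" "linear (\<lambda>w. dG a v w e)" "linear (dG a v w)"
proof -
  show "linear (\<lambda>v. dG a v w e)" for w e
    unfolding dG_def by (rule linear_dd[OF diff_metric[OF assms]])
  show l: "linear (\<lambda>w. dG a v w e)" for e
  proof (rule linearI)
    fix w w' :: "real ^ 'e" and c :: real
    have "dG a v (w + w') e = dd v (\<lambda>b. G b w e + G b w' e) a"
      unfolding dG_def
      by (rule dd_cong_open[OF open_domain assms]) (simp add: linear_add[OF inner_form.lin(1)[OF form]])
    also have "\<dots> = dG a v w e + dG a v w' e" unfolding dG_def
      by (rule dd_eq) (intro has_derivative_add dd_works diff_metric assms)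
    finally show "dG a v (w + w') e = dG a v w e + dG a v w' e" .
    have "dG a v (c *\<^sub>R w) e = dd v (\<lambda>b. c * G b w e) a"
      unfolding dG_def
      by (rule dd_cong_open[OF open_domain assms]) (simp add: linear_scale[OF inner_form.lin(1)[OF form]])
    also have "\<dots> = c * dG a v w e" unfolding dG_def
      by (rule dd_eq) (intro has_derivative_mult_right dd_works diff_metric assms)
    finally show "dG a v (c *\<^sub>R w) e = c *\<^sub>R dG a v w e" by simp
  qed
  show "linear (dG a v w)"
    using l[of w] dG_sym[OF assms, of v w] by presburger
qed

lemma christoffel:
  assumes "a \<in> S"
  shows "2 * G a (christoffel G a v w) e = dG a v w e + dG a w v e - dG a e v w"
proof -
  have lin: "linear (\<lambda>e. (1 / 2) *\<^sub>R (dG a v w e + dG a w v e - dG a e v w))"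
    by (intro linear_compose_scale_right linear_compose_sub linear_compose_add linear_dG assms)
  have "christoffel G a v w = (THE z. \<forall>e. G a z e = (1 / 2) *\<^sub>R (dG a v w e + dG a w v e - dG a e v w))"
    unfolding christoffel_def dG_def by (intro arg_cong[where f = The] ext) (auto simp: field_simps)
  then show ?thesis using inner_form.the_riesz[OF form[OF assms] lin, of e] by simp
qed

text \<open>
  The Koszul formula makes the connection metric: of the six terms of the two Christoffel symbols, four
  cancel by symmetry of the metric and the other two agree.
\<close>

lemma metric_compatible:
  assumes "a \<in> S"
  shows "dG a v w e = G a (christoffel G a v w) e + G a (christoffel G a v e) w"
  using christoffel[OF assms, of v w e] christoffel[OF assms, of v e w]
    dG_sym[OF assms, of v w e] dG_sym[OF assms, of w v e] dG_sym[OF assms, of e v w]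
  by linarith

lemma linear_christoffel:
  assumes "a \<in> S"
  shows "linear (\<lambda>v. christoffel G a v w)"
proof -
  note nd = inner_form.nondegenerate[OF form[OF assms]]
    and lins = inner_form.lin(1)[OF form[OF assms]]
    and dGs = linear_dG[OF assms]
  have half: "G a (christoffel G a v w) e = (dG a v w e + dG a w v e - dG a e v w) / 2" for v w e
    using christoffel[OF assms, of v w e] by simp
  show ?thesis
  proof (rule linearI; rule nd)
    fix v v' e :: "real ^ 'e" and c :: real
    show "G a (christoffel G a (v + v') w) e = G a (christoffel G a v w + christoffel G a v' w) e"
      unfolding linear_add[OF lins] half
      by (simp add: linear_add[OF dGs(1)] linear_add[OF dGs(2)] field_simps)
    show "G a (christoffel G a (c *\<^sub>R v) w) e = G a (c *\<^sub>R christoffel G a v w) e"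
      unfolding linear_scale[OF lins] half
      by (simp add: linear_scale[OF dGs(1)] linear_scale[OF dGs(2)] field_simps)
  qed
qed

lemma gradient:
  assumes "a \<in> S" "u differentiable at a"
  shows "G a (gradient G u a) v = dd v u a"
  unfolding gradient_def
  by (rule inner_form.the_riesz[OF form[OF assms(1)] linear_dd[OF assms(2)]])

text \<open>
  In the standard basis the gradient solves a linear system with differentiable coefficients and
  nonvanishing determinant, so by Cramer's rule its components are quotients of differentiable
  functions.
\<close>

lemma differentiable_gradient:
  assumes u: "\<And>b. b \<in> S \<Longrightarrow> u differentiable at b" "\<And>v. dd v u differentiable at a" and a: "a \<in> S"
  shows "gradient G u differentiable at a"
proof -
  define M where "M b = (\<chi> i j. G b (axis j 1) (axis i 1))" for b
  define p where "p b = (\<chi> i. dd (axis i 1) u b)" for b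
  have M: "M b *v w = (\<chi> i. G b w (axis i 1))" if "b \<in> S" for b w
  proof -
    have "G b w e = (\<Sum>j\<in>UNIV. G b (axis j 1) e * w $ j)" for e
    proof -
      have "G b w e = G b (\<Sum>j\<in>UNIV. w $ j *\<^sub>R axis j 1) e"
        using basis_expansion[of w] by (simp add: scalar_mult_eq_scaleR)
      also have "\<dots> = (\<Sum>j\<in>UNIV. G b (axis j 1) e * w $ j)"
        by (simp add: linear_sum[OF inner_form.lin(1)[OF form[OF that]]] linear_scale[OF inner_form.lin(1)[OF form[OF that]]] mult.commute)
      finally show ?thesis .
    qed
    then show ?thesis by (simp add: M_def matrix_vector_mult_def)
  qed
  have det: "det (M b) \<noteq> 0" if b: "b \<in> S" for b
  proof -
    have "w = 0" if "M b *v w = 0" for w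
    proof (rule ccontr)
      assume "w \<noteq> 0"
      have "G b w = (\<lambda>_. 0)"
      proof (rule linear_eq_stdbasis[OF inner_form.lin(2)[OF form[OF b]]])
        fix e :: "real ^ 'e" assume "e \<in> Basis"
        then obtain i where "e = axis i 1" by (auto simp: Basis_vec_def)
        moreover have "(M b *v w) $ i = 0" for i using that by simp
        ultimately show "G b w e = 0" by (simp add: M[OF b])
      qed (simp add: module_hom_zero)
      then show False using inner_form.pos[OF form[OF b] \<open>w \<noteq> 0\<close>] by simp
    qed
    then show ?thesis
      using matrix_left_invertible_ker[of "M b"] invertible_left_inverse invertible_det_nz by blast
  qed
  have sol: "gradient G u b = (\<chi> k. det (\<chi> i j. if j = k then p b $ i else M b $ i $ j) / det (M b))"
    if "b \<in> S" for b
    unfolding cramer[OF det[OF that], symmetric]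
    by (simp add: M[OF that] p_def gradient[OF that u(1)[OF that]])
  have "(\<lambda>b. \<chi> k. det (\<chi> i j. if j = k then p b $ i else M b $ i $ j) / det (M b)) differentiable at a"
  proof (subst differentiable_componentwise_within, rule ballI)
    fix i :: "real ^ 'e" assume "i \<in> Basis"
    then obtain k where i: "i = axis k 1" by (auto simp: Basis_vec_def)
    have M': "(\<lambda>b. M b $ i $ j) differentiable at a" for i j
      by (simp add: M_def diff_metric[OF a])
    have "(\<lambda>b. (\<chi> i j. if j = k then p b $ i else M b $ i $ j) $ i $ j) differentiable at a" for i j
      using M'[of i j] u(2)[of "axis i 1"] by (cases "j = k") (simp_all add: p_def)
    then have "(\<lambda>b. det (\<chi> i j. if j = k then p b $ i else M b $ i $ j)) differentiable at a"
      by (rule differentiable_det)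
    then show "(\<lambda>b. (\<chi> k. det (\<chi> i j. if j = k then p b $ i else M b $ i $ j) / det (M b)) \<bullet> i) differentiable at a"
      unfolding i inner_axis using det[OF a] M'
      by (simp add: differentiable_divide differentiable_det)
  qed
  then show ?thesis
    by (rule differentiable_cong_open[OF open_domain a, rotated]) (simp add: sol)
qed

text \<open>
  Differentiating \<open>G(grad u, e) = Du(e)\<close> in the direction \<open>v\<close> and using metric compatibility gives
  \<open>G(\<nabla>\<^sub>v grad u, e) = D\<^sup>2u(v, e) - Du(\<Gamma>(v, e))\<close>.  An isometry \<open>K\<close> of the tangent space with a Euclidean
  space of any type turns the trace that defines the divergence into a sum over the orthonormal basis
  \<open>inv K i\<close>.  The freedom in the target of \<open>K\<close> allows product spaces, which split the basis into
  directions along the sphere and the direction along the profile curve.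
\<close>

lemma metric_laplacian_eq_trace_hessian:
  assumes u: "\<And>b. b \<in> S \<Longrightarrow> u differentiable at b" "\<And>v. dd v u differentiable at a" and a: "a \<in> S"
    and K: "linear K" "bij K" "\<And>v w. G a v w = K v \<bullet> (K w :: 'd::euclidean_space)"
  shows "metric_laplacian G u a =
    (\<Sum>i\<in>Basis. dd (inv K i) (dd (inv K i) u) a - dd (christoffel G a (inv K i) (inv K i)) u a)"
proof -
  define W where "W = gradient G u"
  have W: "W differentiable at a" unfolding W_def by (rule differentiable_gradient[OF u a])
  note lin = inner_form.lin[OF form[OF a]]
  have hess: "G a (levi_civita G W a v) e = dd v (dd e u) a - dd (christoffel G a v e) u a" for v e
  proof -
    \<comment> \<open>The base point and the vector \<open>W b\<close> vary together; a basis expansion of \<open>W b\<close> separates them.\<close>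
    have exp: "G b x e = (\<Sum>i\<in>Basis. (x \<bullet> i) * G b i e)" if "b \<in> S" for b x
    proof -
      have "G b x e = G b (\<Sum>i\<in>Basis. (x \<bullet> i) *\<^sub>R i) e" by (simp add: euclidean_representation)
      also have "\<dots> = (\<Sum>i\<in>Basis. (x \<bullet> i) * G b i e)"
        by (simp add: linear_sum[OF inner_form.lin(1)[OF form[OF that]]] linear_scale[OF inner_form.lin(1)[OF form[OF that]]] del: euclidean_representation)
      finally show ?thesis .
    qed
    have expd: "dG a v x e = (\<Sum>i\<in>Basis. (x \<bullet> i) * dG a v i e)" for x
    proof -
      have "dG a v x e = dG a v (\<Sum>i\<in>Basis. (x \<bullet> i) *\<^sub>R i) e" by (simp add: euclidean_representation)
      also have "\<dots> = (\<Sum>i\<in>Basis. (x \<bullet> i) * dG a v i e)"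
        by (simp add: linear_sum[OF linear_dG(2)[OF a]] linear_scale[OF linear_dG(2)[OF a]] del: euclidean_representation)
      finally show ?thesis .
    qed
    have "dd v (dd e u) a = dd v (\<lambda>b. \<Sum>i\<in>Basis. (W b \<bullet> i) * G b i e) a"
      by (rule dd_cong_open[OF open_domain a]) (simp add: exp[symmetric] W_def gradient u)
    also have "\<dots> = (\<Sum>i\<in>Basis. (W a \<bullet> i) * dG a v i e + (dd v W a \<bullet> i) * G a i e)"
      unfolding dG_def
      by (rule dd_eq) (intro has_derivative_sum has_derivative_mult has_derivative_inner_left dd_works W diff_metric a)
    also have "\<dots> = dG a v (W a) e + G a (dd v W a) e"
      by (simp add: sum.distrib exp[OF a, of "dd v W a"] expd[of "W a"])
    also have "\<dots> = G a (levi_civita G W a v) e + G a (christoffel G a v e) (W a)"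
      by (simp add: metric_compatible[OF a, of v "W a"] levi_civita_def linear_add[OF lin(1)])
    also have "G a (christoffel G a v e) (W a) = dd (christoffel G a v e) u a"
      unfolding W_def inner_form.sym[OF form[OF a], of _ "gradient G u a"] by (rule gradient[OF a u(1)[OF a]])
    finally show ?thesis by simp
  qed
  define A where "A = levi_civita G W a"
  have A: "linear A"
    unfolding A_def levi_civita_def
    by (intro linear_compose_add linear_dd W linear_christoffel a)
  have inv: "\<And>v. inv K (K v) = v" "\<And>i. K (inv K i) = i"
    using K(2) by (auto simp: bij_def inv_f_f surj_f_inv_f)
  have "linear (inv K)"
    by (rule linearI) (metis inv linear_add[OF K(1)], metis inv linear_scale[OF K(1)])
  note K' = this inv
  \<comment> \<open>Conjugating by \<open>K\<close> turns the trace over the standard basis into one over an orthonormal basis.\<close>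
  have "metric_laplacian G u a = (\<Sum>b\<in>Basis. inv K (K (A b)) \<bullet> b)"
    by (simp add: metric_laplacian_def divergence_def A_def W_def K')
  also have "\<dots> = (\<Sum>i\<in>Basis. K (A (inv K i)) \<bullet> i)"
    using linear_trace_commute[OF K'(1) linear_compose[OF A K(1)]] by simp
  also have "\<dots> = (\<Sum>i\<in>Basis. G a (A (inv K i)) (inv K i))"
    by (simp add: K K')
  finally show ?thesis by (simp add: A_def hess)
qed

end

section \<open>Further rules for second derivatives\<close>

lemma dd_linear_compose:
  assumes "bounded_linear L" "f differentiable at x"
  shows "dd v (\<lambda>x. L (f x)) x = L (dd v f x)" "(\<lambda>x. L (f x)) differentiable at x"
proof -
  have "((\<lambda>x. L (f x)) has_derivative (\<lambda>v. L (dd v f x))) (at x)"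
    by (rule bounded_linear.has_derivative[OF assms(1) dd_works[OF assms(2)]])
  then show "dd v (\<lambda>x. L (f x)) x = L (dd v f x)" "(\<lambda>x. L (f x)) differentiable at x"
    by (auto simp: dd_eq differentiable_def)
qed

lemma higher_diff_linear_compose:
  assumes L: "bounded_linear L" and U: "open U" and f: "higher_differentiable_on U f k"
  shows "higher_differentiable_on U (\<lambda>x. L (f x)) k"
  using f
proof (induction k arbitrary: f)
  case 0
  then show ?case by (auto intro!: bounded_linear.continuous_on[OF L])
next
  case (Suc k)
  have "higher_differentiable_on U (dd v (\<lambda>x. L (f x))) k" for v
    by (rule higher_diff_cong[OF U _ Suc.IH[of "dd v f"]]) (use Suc.prems in \<open>auto simp: dd_linear_compose[OF L]\<close>)
  then show ?case using Suc.prems dd_linear_compose(2)[OF L] by auto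
qed

lemma dd_mult:
  fixes p q :: "'a::real_normed_vector \<Rightarrow> real"
  assumes "p differentiable at x" "q differentiable at x"
  shows "dd v (\<lambda>x. p x * q x) x = p x * dd v q x + dd v p x * q x"
  by (rule dd_eq) (rule has_derivative_mult[OF dd_works[OF assms(1)] dd_works[OF assms(2)]])

lemma second_derivative_mult:
  fixes p q :: "'a::real_normed_vector \<Rightarrow> real"
  assumes U: "open U" "a \<in> U"
    and p: "\<And>b. b \<in> U \<Longrightarrow> p differentiable at b" "\<And>v. dd v p differentiable at a"
    and q: "\<And>b. b \<in> U \<Longrightarrow> q differentiable at b" "\<And>v. dd v q differentiable at a"
  shows "dd v (dd v (\<lambda>x. p x * q x)) a =
      p a * dd v (dd v q) a + 2 * dd v p a * dd v q a + dd v (dd v p) a * q a"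
    "dd v (\<lambda>x. p x * q x) differentiable at a"
proof -
  have "((\<lambda>b. p b * dd v q b + dd v p b * q b) has_derivative
     (\<lambda>w. (p a * dd w (dd v q) a + dd w p a * dd v q a) + (dd v p a * dd w q a + dd w (dd v p) a * q a))) (at a)"
    by (intro has_derivative_add has_derivative_mult dd_works p q U)
  then have *: "(dd v (\<lambda>x. p x * q x) has_derivative
     (\<lambda>w. (p a * dd w (dd v q) a + dd w p a * dd v q a) + (dd v p a * dd w q a + dd w (dd v p) a * q a))) (at a)"
    by (rule has_derivative_transform_within_open[OF _ U]) (simp add: dd_mult p q)
  show "dd v (dd v (\<lambda>x. p x * q x)) a =
      p a * dd v (dd v q) a + 2 * dd v p a * dd v q a + dd v (dd v p) a * q a"
    unfolding dd_eq[OF *] by (simp add: algebra_simps)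
  from * show "dd v (\<lambda>x. p x * q x) differentiable at a" by (auto simp: differentiable_def)
qed

lemma second_derivative_scale:
  fixes h :: "'a::euclidean_space \<Rightarrow> real"
  assumes "higher_differentiable_on U h 2" "open U" "x \<in> U"
  shows "dd (c *\<^sub>R v) (dd (c *\<^sub>R v) h) x = c\<^sup>2 * dd v (dd v h) x"
proof -
  have "dd (c *\<^sub>R v) (dd (c *\<^sub>R v) h) x = (\<Sum>i\<in>Basis. (c * (v \<bullet> i)) * (c * dd v (dd i h) x))"
    unfolding second_derivative_Basis_sum[OF assms, where v = "c *\<^sub>R v"]
    using linear_dd[OF higher_diff_2D(2)[OF assms(1,3)]] by (simp add: linear_scale)
  also have "\<dots> = c\<^sup>2 * dd v (dd v h) x"
    unfolding second_derivative_Basis_sum[OF assms, where v = v]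
    by (simp add: sum_distrib_left power2_eq_square mult_ac)
  finally show ?thesis .
qed

lemma weighted_pullback_derivative:
  fixes \<rho> :: "'e::real_normed_vector \<Rightarrow> real" and Y :: "'e \<Rightarrow> 'b::euclidean_space"
  assumes \<rho>: "\<rho> differentiable at a" and Y: "higher_differentiable_on U Y 2" "a \<in> U"
  shows "((\<lambda>b. \<rho> b * (dd v Y b \<bullet> dd w Y b)) has_derivative
    (\<lambda>e. \<rho> a * (dd v Y a \<bullet> dd e (dd w Y) a + dd e (dd v Y) a \<bullet> dd w Y a)
        + dd e \<rho> a * (dd v Y a \<bullet> dd w Y a))) (at a)"
  by (intro has_derivative_mult has_derivative_inner dd_works \<rho> higher_diff_2D(2)[OF Y])

section \<open>The Laplacian of the sphere\<close>

text \<open>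
  A point \<open>y\<close> of the unit sphere with an isometric identification \<open>\<iota>\<close> of the tangent space \<open>y\<^sup>\<bottom>\<close>.
\<close>

locale tangent_frame =
  fixes y :: "'b::euclidean_space" and \<iota> :: "real ^ 'k \<Rightarrow> 'b"
  assumes norm_y: "norm y = 1" and lin_\<iota>: "linear \<iota>"
    and range_\<iota>: "range \<iota> = {q. y \<bullet> q = 0}" and norm_\<iota>: "norm (\<iota> z) = norm z"
begin

definition proj :: "'b \<Rightarrow> real ^ 'k" where "proj = adjoint \<iota>"

lemma lin_proj: "linear proj"
  unfolding proj_def by (rule adjoint_linear[OF lin_\<iota>])

lemma bl_proj: "bounded_linear proj"
  using lin_proj by (simp add: linear_conv_bounded_linear)

lemma proj_inner: "proj q \<bullet> z = q \<bullet> \<iota> z"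
  unfolding proj_def by (metis adjoint_works inner_commute lin_\<iota>)

lemma y_inner: "y \<bullet> y = 1"
  using norm_y by (simp add: norm_eq_1)

lemma \<iota>_inner: "\<iota> z \<bullet> \<iota> w = z \<bullet> w"
proof -
  have "norm (\<iota> (z + w)) = norm (z + w)" by (rule norm_\<iota>)
  then have "\<iota> (z + w) \<bullet> \<iota> (z + w) = (z + w) \<bullet> (z + w)" by (simp add: norm_eq)
  moreover have "\<iota> z \<bullet> \<iota> z = z \<bullet> z" "\<iota> w \<bullet> \<iota> w = w \<bullet> w" using norm_\<iota> by (simp_all add: norm_eq)
  ultimately show ?thesis by (simp add: linear_add[OF lin_\<iota>] inner_add inner_commute)
qed

lemma proj_\<iota>: "proj (\<iota> z) = z"
  by (rule vector_eq_rdot[THEN iffD1, rule_format]) (simp add: proj_inner \<iota>_inner)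

lemma y_\<iota>: "y \<bullet> \<iota> z = 0"
  using range_\<iota> by auto

lemma proj_y: "proj y = 0"
  using proj_inner[of y "proj y"] y_\<iota> by simp

lemma \<iota>_proj: "\<iota> (proj q) = q - (y \<bullet> q) *\<^sub>R y"
proof -
  have "y \<bullet> (q - (y \<bullet> q) *\<^sub>R y) = 0" by (simp add: inner_diff_right y_inner)
  then obtain z where z: "q - (y \<bullet> q) *\<^sub>R y = \<iota> z" using range_\<iota> by (metis (mono_tags, lifting) mem_Collect_eq rangeE)
  then have "proj q = z"
    using proj_\<iota>[of z] by (simp add: z[symmetric] linear_diff[OF lin_proj] linear_scale[OF lin_proj] proj_y)
  then show ?thesis using z by simp
qed

lemma proj_inner_proj: "y \<bullet> p = 0 \<Longrightarrow> proj q \<bullet> proj p = q \<bullet> p"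
  by (simp add: proj_inner \<iota>_proj)

end

lemma sphere_tangent:
  assumes "open U" "b \<in> U" "Y ` U \<subseteq> sphere 0 1" "Y differentiable at b"
  shows "Y b \<bullet> dd v Y b = 0"
proof -
  have "((\<lambda>b. Y b \<bullet> Y b) has_derivative (\<lambda>v. Y b \<bullet> dd v Y b + dd v Y b \<bullet> Y b)) (at b)"
    by (intro has_derivative_inner dd_works assms)
  from dd_eq[OF this, of v] have "2 * (Y b \<bullet> dd v Y b) = dd v (\<lambda>b. Y b \<bullet> Y b) b"
    by (simp add: inner_commute)
  also have "\<dots> = dd v (\<lambda>b. 1) b"
    by (rule dd_cong_open[OF assms(1,2)]) (use assms(3) in \<open>auto simp: norm_eq_1\<close>)
  finally show ?thesis by simp
qed

text \<open>
  The differential of \<open>z = proj \<circ> Y\<close> at \<open>a\<close> is an isometry for the induced metric, because tangent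
  vectors lie in \<open>y\<^sup>\<bottom>\<close>, where \<open>proj\<close> is isometric.  Testing the Koszul formula against all vectors gives
  \<open>dz(\<Gamma>(v, v)) = D\<^sup>2z(v, v)\<close>: the graph coordinates have vanishing Hessian at \<open>a\<close>.  In the Hessian of
  \<open>h \<circ> z\<close> only the second derivative of \<open>h\<close> survives.
\<close>

lemma (in tangent_frame) sphere_laplacian_graph_chart:
  fixes Y :: "real ^ 'k \<Rightarrow> 'b"
  assumes U: "open U" "a \<in> U" and Y: "higher_differentiable_on U Y 2" "Y ` U \<subseteq> sphere 0 1"
      "\<And>b. b \<in> U \<Longrightarrow> inj (\<lambda>v. dd v Y b)" "Y a = y"
    and h: "higher_differentiable_on V h 2" "open V" "(\<lambda>b. proj (Y b)) ` U \<subseteq> V"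
    and u: "\<And>b. b \<in> U \<Longrightarrow> u b = h (proj (Y b))"
  shows "metric_laplacian (induced_metric Y) u a = (\<Sum>i\<in>Basis. dd i (dd i h) 0)"
proof -
  define z where "z = (\<lambda>b. proj (Y b))"
  have z: "higher_differentiable_on U z 2"
    unfolding z_def by (rule higher_diff_linear_compose[OF bl_proj U(1) Y(1)])
  have dz: "dd v z b = proj (dd v Y b)" if "b \<in> U" for v b
    unfolding z_def by (rule dd_linear_compose[OF bl_proj higher_diff_2D(1)[OF Y(1) that]])
  have ddz: "dd w (dd v z) a = proj (dd w (dd v Y) a)" for v w
  proof -
    have "dd w (dd v z) a = dd w (\<lambda>b. proj (dd v Y b)) a" by (rule dd_cong_open[OF U dz])
    then show ?thesis using dd_linear_compose(1)[OF bl_proj higher_diff_2D(2)[OF Y(1) U(2)]] by metis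
  qed
  have tan: "y \<bullet> dd v Y a = 0" for v
    using sphere_tangent[OF U Y(2) higher_diff_2D(1)[OF Y(1) U(2)]] Y(4) by simp
  have proj_tan: "proj (dd v Y a) \<bullet> proj q = dd v Y a \<bullet> q" for v q
    using proj_inner_proj[OF tan, of q v] by (simp add: inner_commute)
  have G: "induced_metric Y b v w = 1 * (dd v Y b \<bullet> dd w Y b)" for b v w
    by (simp add: induced_metric_def)
  have derG: "((\<lambda>b. induced_metric Y b v w) has_derivative
      (\<lambda>e. dd v Y b \<bullet> dd e (dd w Y) b + dd e (dd v Y) b \<bullet> dd w Y b)) (at b)" if "b \<in> U" for b v w
    using weighted_pullback_derivative[OF differentiable_const[of 1] Y(1) that, of v w] unfolding G by simp
  interpret local_metric U "induced_metric Y"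
  proof
    show "open U" by (rule U)
    fix b assume b: "b \<in> U"
    note lin = linear_dd[OF higher_diff_2D(1)[OF Y(1) b]]
    show "(\<lambda>b. induced_metric Y b v w) differentiable at b" for v w
      using derG[OF b] by (auto simp: differentiable_def)
    show "bilinear (induced_metric Y b)"
      unfolding bilinear_def induced_metric_def using lin
      by (auto intro!: linearI simp: linear_add linear_scale inner_add)
    show "induced_metric Y b v w = induced_metric Y b w v" for v w
      by (simp add: induced_metric_def inner_commute)
    show "0 < induced_metric Y b v v" if "v \<noteq> 0" for v
      using that linear_injective_0[OF lin] Y(3)[OF b] by (auto simp: induced_metric_def)
  qed
  define K where "K = (\<lambda>v. dd v z a)"
  have KG: "induced_metric Y a v w = K v \<bullet> K w" for v w
    by (simp add: K_def dz U induced_metric_def proj_inner_proj tan)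
  have linK: "linear K" unfolding K_def by (rule linear_dd[OF higher_diff_2D(1)[OF z U(2)]])
  have "inj K"
    unfolding linear_injective_0[OF linK]
    using KG inner_form.pos[OF form[OF U(2)]] by (metis inner_zero_left less_irrefl)
  then have bijK: "bij K" using linear_injective_imp_surjective[OF linK] by (simp add: bij_def)
  have \<Gamma>: "K (christoffel (induced_metric Y) a v v) = dd v (dd v z) a" for v
  proof -
    define q where "q = K (christoffel (induced_metric Y) a v v) - dd v (dd v z) a"
    obtain e where e: "K e = q" using bijK by (metis bij_pointE)
    have "2 * (K (christoffel (induced_metric Y) a v v) \<bullet> K e) = 2 * (dd v (dd v z) a \<bullet> K e)"
      using christoffel[OF U(2), of v v e] mixed_derivatives[OF Y(1) U, of v e]
      unfolding dG_def dd_eq[OF derG[OF U(2)]] KG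
      by (simp add: ddz K_def dz[OF U(2)] proj_inner_proj[OF tan] proj_tan inner_commute)
    then have "q \<bullet> q = 0" unfolding e unfolding q_def[symmetric] by (simp add: q_def inner_diff_left)
    then show ?thesis by (simp add: q_def)
  qed
  have z0: "z a = 0" by (simp add: z_def Y proj_y)
  have uz: "u b = h (z b)" if "b \<in> U" for b by (simp add: z_def u that)
  have zV: "z ` U \<subseteq> V" using h(3) by (simp add: z_def)
  note hz = second_derivative_compose[OF h(1,2) z U(1) zV U(2)]
  have du: "dd v u b = dd v (\<lambda>b. h (z b)) b" if "b \<in> U" for v b
    by (rule dd_cong_open[OF U(1) that uz])
  have zinV: "z b \<in> V" if "b \<in> U" for b using zV that by blast
  have h1: "dd w (\<lambda>b. h (z b)) a = dd (dd w z a) h (z a)" for w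
    by (rule dd_compose(1)[OF higher_diff_2D(1)[OF z U(2)] higher_diff_2D(1)[OF h(1) zinV[OF U(2)]]])
  have "metric_laplacian (induced_metric Y) u a
      = (\<Sum>i\<in>Basis. dd (inv K i) (dd (inv K i) u) a - dd (christoffel (induced_metric Y) a (inv K i) (inv K i)) u a)"
  proof (rule metric_laplacian_eq_trace_hessian[OF _ _ U(2) linK bijK KG])
    show "u differentiable at b" if "b \<in> U" for b
      by (rule differentiable_cong_open[OF U(1) that uz[symmetric]])
        (assumption, rule dd_compose(2)[OF higher_diff_2D(1)[OF z that] higher_diff_2D(1)[OF h(1) zinV[OF that]]])
    show "dd v u differentiable at a" for v
      by (rule differentiable_cong_open[OF U du[symmetric] hz(2)])
  qed
  also have "\<dots> = (\<Sum>i\<in>Basis. dd i (dd i h) 0)"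
  proof (rule sum.cong[OF refl])
    fix i :: "real ^ 'k"
    define v where "v = inv K i"
    have v: "K v = i" unfolding v_def using bijK by (simp add: bij_def surj_f_inv_f)
    have "dd v (dd v u) a = dd v (dd v (\<lambda>b. h (z b))) a"
      by (rule dd_cong_open[OF U du])
    also have "\<dots> = dd i (dd i h) 0 + dd (dd v (dd v z) a) h 0"
      unfolding hz using v by (simp add: z0 K_def)
    finally have "dd v (dd v u) a = dd i (dd i h) 0 + dd (dd v (dd v z) a) h 0" .
    moreover have "dd (christoffel (induced_metric Y) a v v) u a = dd (dd v (dd v z) a) h 0"
      using \<Gamma>[of v] by (simp add: du[OF U(2)] h1 z0 K_def)
    ultimately show "dd (inv K i) (dd (inv K i) u) a
        - dd (christoffel (induced_metric Y) a (inv K i) (inv K i)) u a = dd i (dd i h) 0"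
      by (simp add: v_def)
  qed
  finally show ?thesis .
qed

section \<open>The Laplacian of a warped product with the sphere\<close>

lemma dd_real:
  fixes g :: "real \<Rightarrow> real"
  assumes "g differentiable at s"
  shows "dd w g s = w * deriv g s"
proof -
  have "(g has_derivative (\<lambda>w. w * deriv g s)) (at s)"
    using assms by (simp add: DERIV_deriv_iff_real_differentiable[symmetric] has_field_derivative_def mult.commute[of _ "deriv g s"])
  then show ?thesis by (rule dd_eq)
qed

lemma deriv_differentiable:
  fixes g :: "real \<Rightarrow> real"
  assumes "higher_differentiable_on UNIV g 2"
  shows "deriv g differentiable at s"
proof -
  have "dd 1 g = deriv g" by (rule ext) (simp add: dd_real higher_diff_2D(1)[OF assms])
  then show ?thesis using higher_diff_2D(2)[OF assms UNIV_I, of 1 s] by simp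
qed

lemma second_dd_real:
  fixes g :: "real \<Rightarrow> real"
  assumes "higher_differentiable_on UNIV g 2"
  shows "dd w (dd v g) s = w * v * deriv (deriv g) s"
proof -
  have "dd v g = (\<lambda>s. v * deriv g s)" by (rule ext) (simp add: dd_real higher_diff_2D(1)[OF assms])
  then have "dd w (dd v g) s = v * dd w (deriv g) s"
    using dd_linear_compose(1)[OF bounded_linear_mult_right[of v] deriv_differentiable[OF assms]] by simp
  then show ?thesis by (simp add: dd_real deriv_differentiable[OF assms])
qed

lemma sum_Basis_prod:
  fixes f :: "'a::euclidean_space \<times> 'b::euclidean_space \<Rightarrow> real"
  shows "sum f Basis = (\<Sum>i\<in>Basis. f (i, 0)) + (\<Sum>i\<in>Basis. f (0, i))"
proof -
  have "inj_on (\<lambda>u. (u::'a, 0::'b)) Basis" "inj_on (\<lambda>u. (0::'a, u::'b)) Basis"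
    by (auto intro!: inj_onI Pair_inject)
  moreover have "(\<lambda>u. (u::'a, 0::'b)) ` Basis \<inter> (\<lambda>u. (0::'a, u::'b)) ` Basis = {}"
    by (auto simp: nonzero_Basis)
  ultimately show ?thesis
    unfolding Basis_prod_def by (subst sum.union_disjoint) (auto simp: sum.reindex)
qed

text \<open>
  The map \<open>K = (r dz, d\<tau>)\<close> is an isometry from the tangent space at \<open>a\<close> to \<open>\<real>\<^sup>n\<^sup>-\<^sup>1 \<times> \<real>\<close>; the basis vectors
  it pulls back are purely spherical or purely along \<open>\<tau>\<close>, so mixed terms \<open>d\<tau> dz\<close> vanish on them.  The
  formula is the sum over this basis of the Hessian of \<open>(h \<circ> z) (g \<circ> \<tau>)\<close>: spherical directions give
  \<open>D\<^sup>2h / r\<^sup>2\<close> and, through the Hessian of \<open>\<tau>\<close>, one term \<open>(r' / r) g'\<close> each; the last direction gives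
  \<open>g''\<close>.
\<close>

lemma (in tangent_frame) warped_laplacian_graph_chart:
  fixes Y :: "real ^ 'n \<Rightarrow> 'b" and \<tau> :: "real ^ 'n \<Rightarrow> real" and r g :: "real \<Rightarrow> real"
  assumes dim: "CARD('n) = CARD('k) + 1"
    and U: "open U" "a \<in> U"
    and Y: "higher_differentiable_on U Y 2" "Y ` U \<subseteq> sphere 0 1" "Y a = y"
    and \<tau>: "higher_differentiable_on U \<tau> 2"
    and imm: "\<And>b. b \<in> U \<Longrightarrow> inj (\<lambda>v. (dd v Y b, dd v \<tau> b))"
    and r: "\<And>s. r differentiable at s" "\<And>s. r s > 0"
    and G: "\<And>b v w. b \<in> U \<Longrightarrow>
        G b v w = (r (\<tau> b))\<^sup>2 * (dd v Y b \<bullet> dd w Y b) + dd v \<tau> b * dd w \<tau> b"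
    and h: "higher_differentiable_on V h 2" "open V" "(\<lambda>b. proj (Y b)) ` U \<subseteq> V"
    and g: "higher_differentiable_on UNIV g 2"
    and u: "\<And>b. b \<in> U \<Longrightarrow> u b = h (proj (Y b)) * g (\<tau> b)"
  shows "metric_laplacian G u a =
    h 0 * (deriv (deriv g) (\<tau> a) + real CARD('k) * (deriv r (\<tau> a) / r (\<tau> a)) * deriv g (\<tau> a))
    + (\<Sum>i\<in>Basis. dd i (dd i h) 0) / (r (\<tau> a))\<^sup>2 * g (\<tau> a)"
proof -
  define z where "z = (\<lambda>b. proj (Y b))"
  define R R' where "R = r (\<tau> a)" and "R' = deriv r (\<tau> a)"
  have R: "R > 0" using r by (simp add: R_def)
  have z: "higher_differentiable_on U z 2"
    unfolding z_def by (rule higher_diff_linear_compose[OF bl_proj U(1) Y(1)])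
  have dz: "dd v z b = proj (dd v Y b)" if "b \<in> U" for v b
    unfolding z_def by (rule dd_linear_compose[OF bl_proj higher_diff_2D(1)[OF Y(1) that]])
  have ddz: "dd w (dd v z) a = proj (dd w (dd v Y) a)" for v w
  proof -
    have "dd w (dd v z) a = dd w (\<lambda>b. proj (dd v Y b)) a" by (rule dd_cong_open[OF U dz])
    then show ?thesis using dd_linear_compose(1)[OF bl_proj higher_diff_2D(2)[OF Y(1) U(2)]] by metis
  qed
  have tan: "y \<bullet> dd v Y a = 0" for v
    using sphere_tangent[OF U Y(2) higher_diff_2D(1)[OF Y(1) U(2)]] Y(3) by simp
  have proj_tan: "proj (dd v Y a) \<bullet> proj q = dd v Y a \<bullet> q" for v q
    using proj_inner_proj[OF tan, of q v] by (simp add: inner_commute)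
  have r\<tau>: "((\<lambda>b. (r (\<tau> b))\<^sup>2) has_derivative (\<lambda>v. 2 * r (\<tau> b) * deriv r (\<tau> b) * dd v \<tau> b)) (at b)"
    if "b \<in> U" for b
  proof -
    have "((\<lambda>b. r (\<tau> b)) has_derivative (\<lambda>v. dd v \<tau> b * deriv r (\<tau> b))) (at b)"
      using diff_chain_at[OF dd_works[OF higher_diff_2D(1)[OF \<tau> that]] dd_works[OF r(1)]]
      by (simp add: o_def dd_real r(1))
    from has_derivative_power[OF this, of 2] show ?thesis by (simp add: mult_ac)
  qed
  have derG: "((\<lambda>b. G b v w) has_derivative
      (\<lambda>e. (r (\<tau> b))\<^sup>2 * (dd v Y b \<bullet> dd e (dd w Y) b + dd e (dd v Y) b \<bullet> dd w Y b)
         + 2 * r (\<tau> b) * deriv r (\<tau> b) * dd e \<tau> b * (dd v Y b \<bullet> dd w Y b)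
         + (dd v \<tau> b * dd e (dd w \<tau>) b + dd e (dd v \<tau>) b * dd w \<tau> b))) (at b)" if "b \<in> U" for b v w
  proof (rule has_derivative_transform_within_open[OF _ U(1) that])
    have "(\<lambda>b. (r (\<tau> b))\<^sup>2) differentiable at b" using r\<tau>[OF that] by (auto simp: differentiable_def)
    from weighted_pullback_derivative[OF this Y(1) that, of v w]
      weighted_pullback_derivative[OF differentiable_const[of 1] \<tau> that, of v w]
    show "((\<lambda>b. (r (\<tau> b))\<^sup>2 * (dd v Y b \<bullet> dd w Y b) + dd v \<tau> b * dd w \<tau> b) has_derivative
      (\<lambda>e. (r (\<tau> b))\<^sup>2 * (dd v Y b \<bullet> dd e (dd w Y) b + dd e (dd v Y) b \<bullet> dd w Y b)
         + 2 * r (\<tau> b) * deriv r (\<tau> b) * dd e \<tau> b * (dd v Y b \<bullet> dd w Y b)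
         + (dd v \<tau> b * dd e (dd w \<tau>) b + dd e (dd v \<tau>) b * dd w \<tau> b))) (at b)"
      unfolding dd_eq[OF r\<tau>[OF that]] by (intro has_derivative_add) simp_all
  qed (simp add: G)
  interpret local_metric U G
  proof
    show "open U" by (rule U)
    fix b assume b: "b \<in> U"
    note linY = linear_dd[OF higher_diff_2D(1)[OF Y(1) b]] and lin\<tau> = linear_dd[OF higher_diff_2D(1)[OF \<tau> b]]
    show "(\<lambda>b. G b v w) differentiable at b" for v w
      using derG[OF b] by (auto simp: differentiable_def)
    show "bilinear (G b)"
      unfolding bilinear_def G[OF b]
      by (auto intro!: linearI simp: G[OF b] linear_add[OF linY] linear_scale[OF linY]
          linear_add[OF lin\<tau>] linear_scale[OF lin\<tau>] inner_add algebra_simps)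
    show "G b v w = G b w v" for v w
      by (simp add: G[OF b] inner_commute)
    show "0 < G b v v" if "v \<noteq> 0" for v
    proof -
      have "(dd v Y b, dd v \<tau> b) \<noteq> (dd 0 Y b, dd 0 \<tau> b)"
        using imm[OF b] that by (auto dest: injD)
      then have "dd v Y b \<noteq> 0 \<or> dd v \<tau> b \<noteq> 0"
        using linear_0[OF linY] linear_0[OF lin\<tau>] by auto
      moreover have "r (\<tau> b) > 0" by (rule r)
      ultimately have "0 < (r (\<tau> b))\<^sup>2 * (dd v Y b \<bullet> dd v Y b) \<or> 0 < dd v \<tau> b * dd v \<tau> b"
        by (auto simp: zero_less_mult_iff)
      moreover have "0 \<le> (r (\<tau> b))\<^sup>2 * (dd v Y b \<bullet> dd v Y b)" "0 \<le> dd v \<tau> b * dd v \<tau> b" by simp_all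
      ultimately show ?thesis unfolding G[OF b] by linarith
    qed
  qed
  note lin\<tau> = linear_dd[OF higher_diff_2D(1)[OF \<tau> U(2)]] and linz = linear_dd[OF higher_diff_2D(1)[OF z U(2)]]
  define K where "K = (\<lambda>v. (R *\<^sub>R dd v z a, dd v \<tau> a))"
  have inner_Y: "dd v Y a \<bullet> dd w Y a = dd v z a \<bullet> dd w z a" for v w
    by (simp add: dz U proj_tan)
  have KG: "G a v w = K v \<bullet> K w" for v w
    by (simp add: K_def G U inner_Y R_def power2_eq_square mult_ac)
  have linK: "linear K" unfolding K_def
    by (rule linearI) (simp_all add: linear_add[OF linz] linear_add[OF lin\<tau>] linear_scale[OF linz] linear_scale[OF lin\<tau>] algebra_simps)
  have injK: "inj K"
    unfolding linear_injective_0[OF linK]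
    using KG inner_form.pos[OF form[OF U(2)]] by (metis inner_zero_left less_irrefl)
  \<comment> \<open>Injectivity suffices because both spaces have one dimension more than the sphere.\<close>
  have "surj K"
  proof -
    have "dim (range K) = DIM((real ^ 'k) \<times> real)"
      using dim_image_eq[OF linK, of UNIV] injK dim by simp
    then show ?thesis using dim_eq_full[of "range K"] linear_subspace_image[OF linK subspace_UNIV] by (simp add: span_eq_iff[THEN iffD2])
  qed
  then have bijK: "bij K" using injK by (simp add: bij_def)
  have onto: "\<exists>e. dd e z a = p \<and> dd e \<tau> a = s" for p s
  proof -
    obtain e where "K e = (R *\<^sub>R p, s)" using \<open>surj K\<close> by (metis surjD)
    then show ?thesis using R by (auto simp: K_def)
  qed
  define \<Gamma> where "\<Gamma> v = christoffel G a v v" for v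
  have koszul: "R\<^sup>2 * (dd (\<Gamma> v) z a \<bullet> dd e z a) + dd (\<Gamma> v) \<tau> a * dd e \<tau> a =
      R\<^sup>2 * (dd v (dd v z) a \<bullet> dd e z a) + 2 * R * R' * dd v \<tau> a * (dd v z a \<bullet> dd e z a)
      - R * R' * dd e \<tau> a * (dd v z a \<bullet> dd v z a) + dd v (dd v \<tau>) a * dd e \<tau> a" for v e
  proof -
    have zz: "dd v (dd v z) a \<bullet> dd e z a = dd v (dd v Y) a \<bullet> dd e Y a" 
      by (simp add: ddz dz[OF U(2)] proj_inner_proj[OF tan])
    have sw: "dd e (dd v Y) a = dd v (dd e Y) a" "dd e (dd v \<tau>) a = dd v (dd e \<tau>) a"
      using mixed_derivatives[OF Y(1) U] mixed_derivatives[OF \<tau> U] by auto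
    have "2 * (R\<^sup>2 * (dd (\<Gamma> v) z a \<bullet> dd e z a) + dd (\<Gamma> v) \<tau> a * dd e \<tau> a) =
      2 * (R\<^sup>2 * (dd v (dd v z) a \<bullet> dd e z a) + 2 * R * R' * dd v \<tau> a * (dd v z a \<bullet> dd e z a)
      - R * R' * dd e \<tau> a * (dd v z a \<bullet> dd v z a) + dd v (dd v \<tau>) a * dd e \<tau> a)"
      using christoffel[OF U(2), of v v e]
      unfolding dG_def dd_eq[OF derG[OF U(2)]] \<Gamma>_def[symmetric] G[OF U(2)] zz
        R_def[symmetric] R'_def[symmetric] sw inner_Y
      by (simp add: inner_commute algebra_simps)
    then show ?thesis by simp
  qed
  \<comment> \<open>The Koszul formula tested against a spherical vector and, next, against the unit vector along \<open>\<tau>\<close>.\<close>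
  have \<Gamma>z: "dd (\<Gamma> v) z a = dd v (dd v z) a + (2 * (R' / R) * dd v \<tau> a) *\<^sub>R dd v z a" for v
  proof -
    define q where "q = dd (\<Gamma> v) z a - (dd v (dd v z) a + (2 * (R' / R) * dd v \<tau> a) *\<^sub>R dd v z a)"
    obtain e where e: "dd e z a = q" "dd e \<tau> a = 0" using onto by blast
    have "R\<^sup>2 * (q \<bullet> q) = R\<^sup>2 * (dd (\<Gamma> v) z a \<bullet> q) - R\<^sup>2 * (dd v (dd v z) a \<bullet> q)
        - 2 * R * R' * dd v \<tau> a * (dd v z a \<bullet> q)"
      using R by (subst (1) q_def) (simp add: inner_diff_left inner_add_left field_simps power2_eq_square)
    also have "\<dots> = 0" using koszul[of v e] unfolding e by simp
    finally show ?thesis using R by (simp add: q_def)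
  qed
  have \<Gamma>\<tau>: "dd (\<Gamma> v) \<tau> a = dd v (dd v \<tau>) a - R * R' * (dd v z a \<bullet> dd v z a)" for v
  proof -
    obtain e where e: "dd e z a = 0" "dd e \<tau> a = 1" using onto by blast
    show ?thesis using koszul[of v e] unfolding e by simp
  qed
  have z0: "z a = 0" by (simp add: z_def Y proj_y)
  have zV: "z ` U \<subseteq> V" using h(3) by (simp add: z_def)
  define p where "p = (\<lambda>b. h (z b))"
  define q where "q = (\<lambda>b. g (\<tau> b))"
  have up: "u b = p b * q b" if "b \<in> U" for b by (simp add: p_def q_def z_def u that)
  note hz = second_derivative_compose[OF h(1,2) z U(1) zV U(2), folded p_def]
  note g\<tau> = second_derivative_compose[OF g open_UNIV \<tau> U(1) subset_UNIV U(2), folded q_def]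
  have zinV: "z b \<in> V" if "b \<in> U" for b using zV that by blast
  have p1: "p differentiable at b" "dd w p b = dd (dd w z b) h (z b)" if "b \<in> U" for b w
    unfolding p_def using dd_compose[OF higher_diff_2D(1)[OF z that] higher_diff_2D(1)[OF h(1) zinV[OF that]]] by auto
  have q1: "q differentiable at b" "dd w q b = dd w \<tau> b * deriv g (\<tau> b)" if "b \<in> U" for b w
    unfolding q_def using that
      dd_compose[OF higher_diff_2D(1)[OF \<tau> that] higher_diff_2D(1)[OF g UNIV_I]] by (auto simp: dd_real higher_diff_2D(1)[OF g UNIV_I])
  have du: "dd v u b = dd v (\<lambda>b. p b * q b) b" if "b \<in> U" for v b
    by (rule dd_cong_open[OF U(1) that up])
  have pq: "dd v (dd v (\<lambda>x. p x * q x)) a =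
      p a * dd v (dd v q) a + 2 * dd v p a * dd v q a + dd v (dd v p) a * q a"
    "dd v (\<lambda>x. p x * q x) differentiable at a" for v
    by (rule second_derivative_mult[OF U]; fact p1(1) hz(2) q1(1) g\<tau>(2))+
  define v where "v i = inv K i" for i
  have v: "dd (v i) z a = fst i /\<^sub>R R" "dd (v i) \<tau> a = snd i" for i
  proof -
    have "K (v i) = i" unfolding v_def using \<open>surj K\<close> by (simp add: surj_f_inv_f)
    then have e: "R *\<^sub>R dd (v i) z a = fst i" and s: "dd (v i) \<tau> a = snd i"
      unfolding K_def by (metis fst_conv, metis snd_conv)
    show "dd (v i) z a = fst i /\<^sub>R R" unfolding e[symmetric] using R by simp
    show "dd (v i) \<tau> a = snd i" by (rule s)
  qed
  have z0V: "0 \<in> V" using zV U(2) z0 by force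
  have lin_h: "linear (\<lambda>v. dd v h 0)" by (rule linear_dd[OF higher_diff_2D(1)[OF h(1) z0V]])
  have hess: "dd (v i) (dd (v i) u) a - dd (\<Gamma> (v i)) u a =
      (dd (fst i) (dd (fst i) h) 0 / R\<^sup>2 + dd (- (2 * (R' / R) * snd i / R) *\<^sub>R fst i) h 0) * g (\<tau> a)
      + 2 * dd (fst i /\<^sub>R R) h 0 * (snd i * deriv g (\<tau> a))
      + h 0 * ((snd i)\<^sup>2 * deriv (deriv g) (\<tau> a) + R' / R * (fst i \<bullet> fst i) * deriv g (\<tau> a))" for i
  proof -
    have h2: "dd (fst i /\<^sub>R R) (dd (fst i /\<^sub>R R) h) 0 = dd (fst i) (dd (fst i) h) 0 / R\<^sup>2"
      unfolding second_derivative_scale[OF h(1,2) z0V] by (simp add: power2_eq_square field_simps)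
    have 1: "dd (v i) (dd (v i) u) a = dd (v i) (dd (v i) (\<lambda>b. p b * q b)) a"
      by (rule dd_cong_open[OF U du])
    have 2: "dd (\<Gamma> (v i)) u a = p a * dd (\<Gamma> (v i)) q a + dd (\<Gamma> (v i)) p a * q a"
      unfolding du[OF U(2)] by (rule dd_mult[OF p1(1)[OF U(2)] q1(1)[OF U(2)]])
    have 3: "dd (v i) (dd (v i) p) a - dd (\<Gamma> (v i)) p a =
        dd (fst i) (dd (fst i) h) 0 / R\<^sup>2 + dd (- (2 * (R' / R) * snd i / R) *\<^sub>R fst i) h 0"
      unfolding hz p1(2)[OF U(2)] \<Gamma>z z0 v linear_add[OF lin_h] h2
      by (simp add: linear_scale[OF lin_h] linear_neg[OF lin_h] field_simps)
    have 4: "dd (v i) (dd (v i) q) a - dd (\<Gamma> (v i)) q a =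
        (snd i)\<^sup>2 * deriv (deriv g) (\<tau> a) + R' / R * (fst i \<bullet> fst i) * deriv g (\<tau> a)"
      unfolding g\<tau> q1(2)[OF U(2)] \<Gamma>\<tau> v second_dd_real[OF g] unfolding dd_real[OF higher_diff_2D(1)[OF g UNIV_I]]
      using R by (simp add: power2_eq_square field_simps)
    have 5: "dd (v i) p a = dd (fst i /\<^sub>R R) h 0" "dd (v i) q a = snd i * deriv g (\<tau> a)"
      by (simp_all add: p1(2)[OF U(2)] q1(2)[OF U(2)] v z0)
    have 6: "p a = h 0" "q a = g (\<tau> a)" by (simp_all add: p_def q_def z0)
    have "dd (v i) (dd (v i) u) a - dd (\<Gamma> (v i)) u a =
       (dd (v i) (dd (v i) p) a - dd (\<Gamma> (v i)) p a) * q a + 2 * dd (v i) p a * dd (v i) q a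
       + p a * (dd (v i) (dd (v i) q) a - dd (\<Gamma> (v i)) q a)"
      unfolding 1 2 pq by (simp add: algebra_simps)
    then show ?thesis unfolding 3 4 5 6 .
  qed
  have "metric_laplacian G u a = (\<Sum>i\<in>Basis. dd (v i) (dd (v i) u) a - dd (\<Gamma> (v i)) u a)"
    unfolding v_def \<Gamma>_def
  proof (rule metric_laplacian_eq_trace_hessian[OF _ _ U(2) linK bijK KG])
    show "u differentiable at b" if "b \<in> U" for b
      by (rule differentiable_cong_open[OF U(1) that up[symmetric]])
        (assumption, rule differentiable_mult[OF p1(1)[OF that] q1(1)[OF that]])
    show "dd v u differentiable at a" for v
      by (rule differentiable_cong_open[OF U du[symmetric] pq(2)])
  qed
  also have "\<dots> = (\<Sum>i\<in>Basis. dd i (dd i h) 0 / R\<^sup>2 * g (\<tau> a) + h 0 * (R' / R * deriv g (\<tau> a)))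
      + h 0 * deriv (deriv g) (\<tau> a)"
    unfolding hess sum_Basis_prod using linear_0[OF lin_h] linear_0[OF linear_dd[OF higher_diff_2D(2)[OF h(1) z0V]]]
    by (simp add: inner_Basis)
  also have "\<dots> = h 0 * (deriv (deriv g) (\<tau> a) + real CARD('k) * (R' / R) * deriv g (\<tau> a))
    + (\<Sum>i\<in>Basis. dd i (dd i h) 0) / R\<^sup>2 * g (\<tau> a)"
    by (simp add: sum.distrib sum_distrib_left sum_distrib_right sum_divide_distrib algebra_simps)
  finally show ?thesis by (simp add: R_def R'_def)
qed

section \<open>Smooth charts of the sphere and of the cylinder\<close>

lemma higher_diff_const: "higher_differentiable_on U (\<lambda>x. c) k"
  by (induction k arbitrary: c) simp_all

lemma higher_diff_bounded_linear: 
  assumes "bounded_linear L"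
  shows "higher_differentiable_on U L k"
proof (cases k)
  case 0
  then show ?thesis using assms by (simp add: linear_continuous_on)
next
  case (Suc j)
  have "dd v L x = L v" for v x by (rule dd_eq) (rule bounded_linear_imp_has_derivative[OF assms])
  then show ?thesis
    using bounded_linear_imp_differentiable[OF assms] by (simp add: Suc higher_diff_const)
qed

lemma higher_diff_add:
  assumes "open U" "higher_differentiable_on U f k" "higher_differentiable_on U g k"
  shows "higher_differentiable_on U (\<lambda>x. f x + g x) k"
  using assms(2,3)
proof (induction k arbitrary: f g)
  case 0
  then show ?case by (auto intro: continuous_intros)
next
  case (Suc k)
  have d: "dd v (\<lambda>x. f x + g x) x = dd v f x + dd v g x" if "x \<in> U" for v x
    by (rule dd_eq) (intro has_derivative_add dd_works; use Suc.prems that in simp)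
  have "higher_differentiable_on U (\<lambda>x. dd v f x + dd v g x) k" for v
    by (rule Suc.IH) (use Suc.prems in auto)
  then have "higher_differentiable_on U (dd v (\<lambda>x. f x + g x)) k" for v
    by (rule higher_diff_cong[OF assms(1), rotated]) (simp add: d)
  moreover have "(\<lambda>x. f x + g x) differentiable at x" if "x \<in> U" for x
    by (rule differentiable_add) (use Suc.prems that in auto)
  ultimately show ?case by simp
qed

lemma higher_diff_scaleR:
  fixes f :: "'a::real_normed_vector \<Rightarrow> real" and g :: "'a \<Rightarrow> 'b::real_normed_vector"
  assumes U: "open U" and "higher_differentiable_on U f k" "higher_differentiable_on U g k"
  shows "higher_differentiable_on U (\<lambda>x. f x *\<^sub>R g x) k"
  using assms(2,3)
proof (induction k arbitrary: f g)
  case 0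
  then show ?case by (auto intro: continuous_intros)
next
  case (Suc k)
  have "((\<lambda>x. f x *\<^sub>R g x) has_derivative (\<lambda>v. f x *\<^sub>R dd v g x + dd v f x *\<^sub>R g x)) (at x)" if "x \<in> U" for x
    by (intro has_derivative_scaleR dd_works; use Suc.prems that in simp)
  then have d: "dd v (\<lambda>x. f x *\<^sub>R g x) x = f x *\<^sub>R dd v g x + dd v f x *\<^sub>R g x"
      "(\<lambda>x. f x *\<^sub>R g x) differentiable at x" if "x \<in> U" for v x
    using dd_eq differentiableI that by blast+
  have "higher_differentiable_on U (\<lambda>x. f x *\<^sub>R dd v g x + dd v f x *\<^sub>R g x) k" for v
    by (intro higher_diff_add[OF U] Suc.IH higher_diff_Suc_imp[OF Suc.prems(1)] higher_diff_Suc_imp[OF Suc.prems(2)])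
      (use Suc.prems in auto)
  then have "higher_differentiable_on U (dd v (\<lambda>x. f x *\<^sub>R g x)) k" for v
    by (rule higher_diff_cong[OF U, rotated]) (simp add: d)
  then show ?case using d by simp
qed

lemma higher_diff_compose_linear:
  assumes L: "bounded_linear L" and UV: "open U" "L ` U \<subseteq> V"
    and f: "higher_differentiable_on V f k"
  shows "higher_differentiable_on U (\<lambda>x. f (L x)) k"
  using f
proof (induction k arbitrary: f)
  case 0
  then show ?case
    using continuous_on_compose2[OF _ linear_continuous_on[OF L] UV(2)] by simp
next
  case (Suc k)
  have "((\<lambda>x. f (L x)) has_derivative (\<lambda>v. dd (L v) f (L x))) (at x)" if "x \<in> U" for x
    using diff_chain_at[OF bounded_linear_imp_has_derivative[OF L] dd_works[of f "L x"]] Suc.prems UV that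
    by (auto simp: o_def)
  then have d: "dd v (\<lambda>x. f (L x)) x = dd (L v) f (L x)"
      "(\<lambda>x. f (L x)) differentiable at x" if "x \<in> U" for v x
    using dd_eq differentiableI that by blast+
  have "higher_differentiable_on U (\<lambda>x. dd (L v) f (L x)) k" for v
    by (rule Suc.IH) (use Suc.prems in auto)
  then have "higher_differentiable_on U (dd v (\<lambda>x. f (L x))) k" for v
    by (rule higher_diff_cong[OF UV(1), rotated]) (simp add: d)
  then show ?case using d by simp
qed

lemma higher_diff_Pair:
  fixes f :: "'a::real_normed_vector \<Rightarrow> 'b::real_normed_vector" and g :: "'a \<Rightarrow> 'c::real_normed_vector"
  assumes "open U" "higher_differentiable_on U f k" "higher_differentiable_on U g k"
  shows "higher_differentiable_on U (\<lambda>x. (f x, g x)) k"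
proof -
  have "bounded_linear (\<lambda>p::'b. (p, 0::'c))" "bounded_linear (\<lambda>q::'c. (0::'b, q))"
    by (intro bounded_linear_Pair bounded_linear_ident bounded_linear_zero)+
  from higher_diff_add[OF assms(1) higher_diff_linear_compose[OF this(1) assms(1,2)] higher_diff_linear_compose[OF this(2) assms(1,3)]]
  show ?thesis by simp
qed

text \<open>
  The exponent is arbitrary because differentiation lowers it by one; the square root in the graph chart
  is the case \<open>p = 1 / 2\<close>.
\<close>

lemma higher_diff_powr_one_minus_norm_sq:
  "higher_differentiable_on (ball 0 1) (\<lambda>z::'a::real_inner. (1 - z \<bullet> z) powr p) k"
proof (induction k arbitrary: p)
  case 0
  have "1 - z \<bullet> z \<noteq> 0" if "z \<in> ball 0 1" for z :: 'a
    using that by (simp add: norm_eq_sqrt_inner)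
  then show ?case by (auto intro!: continuous_intros)
next
  case (Suc k)
  have pos: "1 - z \<bullet> z > 0" if "z \<in> ball 0 1" for z :: 'a
    using that by (simp add: norm_eq_sqrt_inner)
  have D: "((\<lambda>z::'a. (1 - z \<bullet> z) powr p) has_derivative
      (\<lambda>v. (1 - z \<bullet> z) powr (p - 1) *\<^sub>R ((- 2 * p) * (z \<bullet> v)))) (at z)" if "z \<in> ball 0 1" for z
  proof -
    have a: "((\<lambda>z::'a. 1 - z \<bullet> z) has_derivative (\<lambda>v. - 2 * (z \<bullet> v))) (at z)"
      by (auto intro!: derivative_eq_intros simp: inner_commute)
    have b: "((\<lambda>s. s powr p) has_derivative (\<lambda>w. (p * (1 - z \<bullet> z) powr (p - 1)) * w)) (at (1 - z \<bullet> z))"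
      using has_real_derivative_powr[OF pos[OF that], of p] by (simp add: has_field_derivative_def)
    from diff_chain_at[OF a b] show ?thesis by (simp add: o_def mult_ac)
  qed
  have d: "dd v (\<lambda>z::'a. (1 - z \<bullet> z) powr p) z = (1 - z \<bullet> z) powr (p - 1) *\<^sub>R ((- 2 * p) * (z \<bullet> v))"
      "(\<lambda>z::'a. (1 - z \<bullet> z) powr p) differentiable at z" if "z \<in> ball 0 1" for v z
    using dd_eq[OF D[OF that]] D[OF that] by (auto simp: differentiable_def)
  have "higher_differentiable_on (ball 0 1) (\<lambda>z::'a. (1 - z \<bullet> z) powr (p - 1) *\<^sub>R ((- 2 * p) * (z \<bullet> v))) k" for v
    by (intro higher_diff_scaleR Suc.IH higher_diff_bounded_linear bounded_linear_intros) auto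
  then have "higher_differentiable_on (ball 0 1) (dd v (\<lambda>z::'a. (1 - z \<bullet> z) powr p)) k" for v
    by (rule higher_diff_cong[rotated 2]) (auto simp: d)
  then show ?case using d by simp
qed

text \<open>
  A linear left inverse settles two conditions on a chart at once: it is the continuous inverse, and
  differentiating \<open>N \<circ> x = id\<close> shows that the differential of \<open>x\<close> is injective.
\<close>

lemma submanifold_atlas_linear_retraction:
  fixes x :: "'e::euclidean_space \<Rightarrow> 'a::euclidean_space"
  assumes U: "open U" and x: "smooth_on U x" and N: "bounded_linear N" "\<And>b. b \<in> U \<Longrightarrow> N (x b) = b"
    and S: "openin (top_of_set S) (x ` U)"
  shows "(U, x) \<in> submanifold_atlas TYPE('e) S"
proof -
  have diff: "x differentiable at b" if "b \<in> U" for b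
    using smooth_onD[OF x, of "Suc 0"] that by simp
  have "inj (\<lambda>v. dd v x b)" if b: "b \<in> U" for b
  proof (rule inj_on_inverseI)
    fix v
    have "N (dd v x b) = dd v (\<lambda>b. N (x b)) b" by (rule dd_linear_compose(1)[OF N(1) diff[OF b], symmetric])
    also have "\<dots> = dd v (\<lambda>b. b) b" by (rule dd_cong_open[OF U b N(2)])
    finally show "N (dd v x b) = v" by simp
  qed
  moreover have "homeomorphism U (x ` U) x N"
    using N smooth_onD[OF x, of 0] linear_continuous_on[OF N(1)]
    by (auto simp: homeomorphism_def image_image)
  ultimately show ?thesis using assms by (auto simp: submanifold_atlas_def)
qed

lemma ex_tangent_frame:
  fixes y :: "real ^ 'n"
  assumes "norm y = 1" "CARD('k) = CARD('n) - 1"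
  obtains \<iota> :: "real ^ 'k \<Rightarrow> real ^ 'n" where "tangent_frame y \<iota>"
proof -
  have "y \<noteq> 0" using assms(1) by auto
  then have "dim (UNIV :: (real ^ 'k) set) = dim {q. y \<bullet> q = 0}"
    using assms(2) dim_hyperplane[of y] by simp
  then obtain \<iota> :: "real ^ 'k \<Rightarrow> real ^ 'n" where "linear \<iota>" "range \<iota> = {q. y \<bullet> q = 0}" "\<And>x. norm (\<iota> x) = norm x"
    using isometry_subspaces[OF subspace_UNIV subspace_hyperplane] by (metis UNIV_I)
  then have "tangent_frame y \<iota>" using assms(1) by (simp add: tangent_frame_def)
  then show thesis by (rule that)
qed

context tangent_frame
begin

text \<open>
  The upper unit hemisphere with pole \<open>y\<close> as a graph over its equatorial hyperplane.  The formula
  describes the hemisphere for \<open>|z| < 1\<close> only.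
\<close>

definition graph :: "real ^ 'k \<Rightarrow> 'b" where
  "graph z = \<iota> z + sqrt (1 - z \<bullet> z) *\<^sub>R y"

lemma smooth_graph: "smooth_on (ball 0 1) graph"
  unfolding smooth_on_def
proof
  fix k
  have "higher_differentiable_on (ball 0 1) (\<lambda>z. \<iota> z + (1 - z \<bullet> z) powr (1 / 2) *\<^sub>R y) k"
    by (intro higher_diff_add higher_diff_scaleR higher_diff_bounded_linear higher_diff_powr_one_minus_norm_sq higher_diff_const)
      (auto simp: lin_\<iota> linear_linear linear_conv_bounded_linear[symmetric])
  then show "higher_differentiable_on (ball 0 1) graph k"
  proof (rule higher_diff_cong[rotated 2])
    fix z :: "real ^ 'k" assume "z \<in> ball 0 1"
    then have "z \<bullet> z \<le> 1" by (simp add: norm_eq_sqrt_inner)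
    then show "\<iota> z + (1 - z \<bullet> z) powr (1 / 2) *\<^sub>R y = graph z"
      by (simp add: graph_def powr_half_sqrt)
  qed simp
qed

lemma proj_graph: "proj (graph z) = z"
  by (simp add: graph_def linear_add[OF lin_proj] linear_scale[OF lin_proj] proj_\<iota> proj_y)

lemma y_graph: "y \<bullet> graph z = sqrt (1 - z \<bullet> z)"
  by (simp add: graph_def inner_add_right y_\<iota> y_inner)

lemma graph_0: "graph 0 = y"
  by (simp add: graph_def linear_0[OF lin_\<iota>])

lemma norm_graph: "norm z < 1 \<Longrightarrow> norm (graph z) = 1"
proof -
  assume "norm z < 1"
  then have "z \<bullet> z \<le> 1" by (simp add: norm_eq_sqrt_inner)
  then have "graph z \<bullet> graph z = z \<bullet> z + sqrt (1 - z \<bullet> z) * sqrt (1 - z \<bullet> z)"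
    unfolding graph_def inner_add_left inner_add_right inner_scaleR_left inner_scaleR_right
      \<iota>_inner y_\<iota> y_inner inner_commute[of "\<iota> z" y] by simp
  also have "\<dots> = 1" using \<open>z \<bullet> z \<le> 1\<close> by simp
  finally have "graph z \<bullet> graph z = 1" .
  then show ?thesis by (simp add: norm_eq_1)
qed

lemma graph_proj:
  assumes "norm q = 1" "y \<bullet> q > 0"
  shows "graph (proj q) = q" "norm (proj q) < 1"
proof -
  have "proj q \<bullet> proj q = \<iota> (proj q) \<bullet> \<iota> (proj q)" by (simp add: \<iota>_inner)
  also have "\<dots> = 1 - (y \<bullet> q)\<^sup>2"
    using assms(1) unfolding \<iota>_proj
    by (simp add: inner_diff_left inner_diff_right y_inner inner_commute[of q y] norm_eq_1 power2_eq_square)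
  finally have *: "proj q \<bullet> proj q = 1 - (y \<bullet> q)\<^sup>2" .
  then show "graph (proj q) = q" using assms(2) by (simp add: graph_def \<iota>_proj)
  have "proj q \<bullet> proj q < 1" using assms(2) by (simp add: *)
  then show "norm (proj q) < 1" by (simp add: norm_eq_sqrt_inner)
qed

lemma graph_image: "graph ` ball 0 1 = {q \<in> sphere 0 1. y \<bullet> q > 0}"
proof safe
  fix z :: "real ^ 'k" assume "z \<in> ball 0 1"
  then have "norm z < 1" by simp
  then show "graph z \<in> sphere 0 1" "y \<bullet> graph z > 0"
    using norm_graph[of z] by (simp_all add: y_graph) (simp add: norm_eq_sqrt_inner)
next
  fix q assume "q \<in> sphere 0 1" "y \<bullet> q > 0"
  then show "q \<in> graph ` ball 0 1" using graph_proj[of q] by (metis dist_0_norm imageI mem_ball mem_sphere)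
qed

lemma open_hemisphere: "open {q. y \<bullet> q > 0}"
  by (intro open_Collect_less continuous_intros)

lemma graph_chart: "(ball 0 1, graph) \<in> submanifold_atlas TYPE(real ^ 'k) (sphere 0 1)"
proof (rule submanifold_atlas_linear_retraction[OF open_ball smooth_graph bl_proj proj_graph])
  have "graph ` ball 0 1 = sphere 0 1 \<inter> {q. y \<bullet> q > 0}" by (auto simp: graph_image)
  then show "openin (top_of_set (sphere 0 1)) (graph ` ball 0 1)"
    using open_hemisphere by (simp add: openin_open_Int)
qed

text \<open>
  The width \<open>\<delta>\<close> is at one's disposal: a chart of \<open>S\<^sup>n\<^sup>-\<^sup>1 \<times> \<real>\<close> descends to the quotient by a period only
  if it is short enough along \<open>\<real>\<close>.
\<close>

lemma graph_cylinder_chart: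
  fixes t \<delta> :: real
  assumes "CARD('n) = CARD('k) + 1" "\<delta> > 0"
  obtains U and x :: "real ^ 'n \<Rightarrow> 'b \<times> real" and a
  where "(U, x) \<in> submanifold_atlas TYPE(real ^ 'n) (sphere 0 1 \<times> UNIV)" "a \<in> U" "x a = (y, t)"
    "\<And>b. b \<in> U \<Longrightarrow> \<bar>snd (x b) - t\<bar> < \<delta>"
proof -
  obtain J :: "real ^ 'n \<Rightarrow> (real ^ 'k) \<times> real" and J' where
    J: "linear J" "linear J'" "\<And>v. J' (J v) = v" "\<And>w. J (J' w) = w"
  proof -
    have "DIM(real ^ 'n) = DIM((real ^ 'k) \<times> real)" using assms(1) by simp
    from isomorphisms_UNIV_UNIV[OF this] that show thesis by metis
  qed
  have bl: "bounded_linear (\<lambda>b. fst (J b))" "bounded_linear (\<lambda>b. snd (J b))"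
      "bounded_linear (\<lambda>p. J' (proj (fst p), snd p))"
  proof -
    note bJ = linear_conv_bounded_linear[THEN iffD1, OF J(1)] and bJ' = linear_conv_bounded_linear[THEN iffD1, OF J(2)]
    show "bounded_linear (\<lambda>b. fst (J b))" "bounded_linear (\<lambda>b. snd (J b))"
      by (rule bounded_linear_compose[OF bounded_linear_fst bJ], rule bounded_linear_compose[OF bounded_linear_snd bJ])
    show "bounded_linear (\<lambda>p::'b \<times> real. J' (proj (fst p), snd p))"
      by (intro bounded_linear_compose[OF bJ'] bounded_linear_Pair
        bounded_linear_compose[OF bl_proj] bounded_linear_fst bounded_linear_snd)
  qed
  define U where "U = {b. fst (J b) \<in> ball 0 1} \<inter> {b. snd (J b) \<in> {t - \<delta> <..< t + \<delta>}}"
  define x where "x b = (graph (fst (J b)), snd (J b))" for b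
  have U: "open U"
    unfolding U_def using open_vimage[OF open_ball linear_continuous_on[OF bl(1)]]
       open_vimage[OF open_greaterThanLessThan linear_continuous_on[OF bl(2)]]
    by (intro open_Int) (simp_all only: vimage_def)
  have "(U, x) \<in> submanifold_atlas TYPE(real ^ 'n) (sphere 0 1 \<times> UNIV)"
  proof (rule submanifold_atlas_linear_retraction[OF U _ bl(3)])
    show "smooth_on U x"
      unfolding smooth_on_def x_def
      by (intro allI higher_diff_Pair U higher_diff_compose_linear[OF bl(1) U _ smooth_onD[OF smooth_graph]] higher_diff_bounded_linear bl)
        (auto simp: U_def)
    show "J' (proj (fst (x b)), snd (x b)) = b" for b
      by (simp add: x_def proj_graph J)
    have "x ` U = graph ` ball 0 1 \<times> {t - \<delta> <..< t + \<delta>}"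
    proof (intro equalityI subsetI)
      fix p assume "p \<in> graph ` ball 0 1 \<times> {t - \<delta> <..< t + \<delta>}"
      then obtain z s where p: "p = (graph z, s)" "z \<in> ball 0 1" "s \<in> {t - \<delta> <..< t + \<delta>}" by blast
      then have "p = x (J' (z, s))" "J' (z, s) \<in> U" by (simp_all add: x_def U_def J)
      then show "p \<in> x ` U" by (rule image_eqI)
    qed (auto simp: x_def U_def)
    also have "\<dots> = (sphere 0 1 \<times> UNIV) \<inter> ({q. y \<bullet> q > 0} \<times> {t - \<delta> <..< t + \<delta>})"
      unfolding graph_image by blast
    finally have "x ` U = \<dots>" .
    then show "openin (top_of_set (sphere 0 1 \<times> UNIV)) (x ` U)"
      by (simp only: openin_open_Int open_Times open_hemisphere open_greaterThanLessThan)
  qed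
  moreover have "J' (0, t) \<in> U" "x (J' (0, t)) = (y, t)"
    using assms(2) by (simp_all add: U_def x_def J graph_0)
  ultimately show thesis by (rule that) (auto simp: U_def x_def abs_less_iff)
qed

end

text \<open>
  Every parametrization around \<open>y\<close> yields the right-hand side, and the graph chart shows that there is
  one, so the description in the definition of the Laplacian determines this number.
\<close>

lemma sphere_laplacian_via_graph:
  fixes fbar :: "real ^ 'n \<Rightarrow> real"
  assumes "tangent_frame y (\<iota> :: real ^ 'k \<Rightarrow> real ^ 'n)"
    and f: "smooth_function (submanifold_atlas TYPE(real ^ 'k) (sphere 0 1)) fbar"
  shows "laplacian (submanifold_atlas TYPE(real ^ 'k) (sphere 0 1)) id fbar y
    = (\<Sum>i\<in>Basis. dd i (dd i (fbar \<circ> tangent_frame.graph y \<iota>)) 0)"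
proof -
  interpret tangent_frame y \<iota> by fact
  define L where "L = (\<Sum>i\<in>Basis. dd i (dd i (fbar \<circ> graph)) 0)"
  have h: "higher_differentiable_on (ball 0 1) (fbar \<circ> graph) 2"
    using f graph_chart by (auto simp: smooth_function_def smooth_on_def)
  have val: "metric_laplacian (induced_metric (id \<circ> x)) (fbar \<circ> x) a = L"
    if chart: "(U, x) \<in> submanifold_atlas TYPE(real ^ 'k) (sphere 0 1)" and a: "a \<in> U" "x a = y" for U x a
  proof -
    have U: "open U" and x: "smooth_on U x" and imm: "\<And>b. b \<in> U \<Longrightarrow> inj (frechet_derivative x (at b))"
      and S: "x ` U \<subseteq> sphere 0 1"
      using chart by (auto simp: submanifold_atlas_def dest: openin_imp_subset)
    \<comment> \<open>The chart may leave the hemisphere, and \<open>graph \<circ> proj\<close> is the identity only on it.\<close>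
    define U' where "U' = U \<inter> x -` {q. y \<bullet> q > 0}"
    have U': "open U'"
      unfolding U'_def using smooth_onD[OF x, of 0] continuous_open_preimage[OF _ U open_hemisphere] by simp
    have sub: "U' \<subseteq> U" by (auto simp: U'_def)
    have gp: "norm (proj (x b)) < 1" "graph (proj (x b)) = x b" if "b \<in> U'" for b
      using that S graph_proj[of "x b"] by (auto simp: U'_def)
    have "metric_laplacian (induced_metric x) (fbar \<circ> x) a = L"
      unfolding L_def
    proof (rule sphere_laplacian_graph_chart[OF U' _ _ _ _ _ h open_ball])
      show "a \<in> U'" using a by (simp add: U'_def y_inner)
      show "higher_differentiable_on U' x 2" by (rule higher_diff_mono_on[OF smooth_onD[OF x] sub])
    qed (use sub S imm a gp in auto)
    then show ?thesis by simp
  qed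
  have "laplacian (submanifold_atlas TYPE(real ^ 'k) (sphere 0 1)) id fbar y = L"
    unfolding laplacian_def
  proof (rule the_equality)
    show "\<forall>(U, x)\<in>submanifold_atlas TYPE(real ^ 'k) (sphere 0 1). \<forall>a\<in>U. x a = y \<longrightarrow>
       metric_laplacian (induced_metric (id \<circ> x)) (fbar \<circ> x) a = L"
      using val by auto
    fix L' assume "\<forall>(U, x)\<in>submanifold_atlas TYPE(real ^ 'k) (sphere 0 1). \<forall>a\<in>U. x a = y \<longrightarrow>
       metric_laplacian (induced_metric (id \<circ> x)) (fbar \<circ> x) a = L'"
    from bspec[OF this graph_chart]
    have "metric_laplacian (induced_metric (id \<circ> graph)) (fbar \<circ> graph) 0 = L'" by (simp add: graph_0)
    then show "L' = L" using val[OF graph_chart, of 0] by (simp add: graph_0)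
  qed
  then show ?thesis by (simp add: L_def)
qed

section \<open>Geometry of rotational hypersurfaces\<close>

locale rotational_profile =
  fixes n :: nat and H c T :: real and r :: "real \<Rightarrow> real" and l m :: int
  assumes smooth_r: "smooth_on UNIV r" and r_bounds: "\<And>t. 0 < r t" "\<And>t. r t < 1"
    and r_period: "\<And>t. r (t + T) = r t"
    and profile: "\<And>t. (deriv r t)\<^sup>2 + (r t)\<^sup>2 * (1 + (curv n H c r t)\<^sup>2) = 1"
    and m: "m \<noteq> 0" and closing: "angle n H c r T = 2 * pi * (of_int l / of_int m)"
begin

definition angular_speed :: "real \<Rightarrow> real" where
  "angular_speed t = r t * curv n H c r t / (1 - (r t)\<^sup>2)"

lemma r_differentiable: "r differentiable at t"
  using smooth_onD[OF smooth_r, of "Suc 0"] by simp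

lemma one_minus_r_sq: "1 - (r t)\<^sup>2 > 0"
  using r_bounds[of t] by (simp add: abs_square_less_1)

lemma has_derivative_r: "(r has_real_derivative deriv r t) (at t)"
  using r_differentiable by (simp add: DERIV_deriv_iff_real_differentiable)

lemma continuous_angular_speed: "continuous_on A angular_speed"
proof -
  have "continuous_on A r"
    using has_derivative_r by (meson DERIV_isCont continuous_at_imp_continuous_on)
  moreover have "r t \<noteq> 0" "1 - (r t)\<^sup>2 \<noteq> 0" for t
    using r_bounds(1)[of t] one_minus_r_sq[of t] by simp_all
  ultimately show ?thesis
    unfolding angular_speed_def curv_def by (intro continuous_intros) auto
qed

lemma has_derivative_angle: "(angle n H c r has_real_derivative angular_speed t) (at t)"
proof -
  have "((\<lambda>u. LBINT y=0..u. angular_speed y) has_vector_derivative angular_speed t) (at t within {- \<bar>t\<bar> - 1..\<bar>t\<bar> + 1})"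
    unfolding zero_ereal_def
    by (rule interval_integral_FTC2) (auto intro: continuous_angular_speed)
  moreover have "at t within {- \<bar>t\<bar> - 1..\<bar>t\<bar> + 1} = at t" by (rule at_within_Icc_at) auto
  moreover have "(\<lambda>u. LBINT y=0..u. angular_speed y) = angle n H c r"
    by (rule ext) (simp add: angle_def angular_speed_def)
  ultimately show ?thesis by (simp add: has_real_derivative_iff_has_vector_derivative)
qed

text \<open>
  The derivative of the angle is \<open>T\<close>-periodic, so the increment over a period is constant.
\<close>

lemma angle_add_T: "angle n H c r (t + T) = angle n H c r t + angle n H c r T"
proof -
  have "((\<lambda>t. angle n H c r (t + T) - angle n H c r t) has_real_derivative (angular_speed (t + T) - angular_speed t)) (at t)" for t
    by (intro DERIV_diff has_derivative_angle) (use has_derivative_angle[of "t + T"] DERIV_shift in blast)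
  moreover have "angular_speed (t + T) - angular_speed t = 0" for t by (simp add: angular_speed_def curv_def r_period)
  ultimately have "\<forall>t. ((\<lambda>t. angle n H c r (t + T) - angle n H c r t) has_real_derivative 0) (at t)" by metis
  from DERIV_isconst_all[OF this, of t 0]
  show ?thesis by (simp add: angle_def zero_ereal_def[symmetric])
qed

lemma period_shift:
  "r (t + of_int j * T) = r t"
  "angle n H c r (t + of_int j * T) = angle n H c r t + of_int j * angle n H c r T"
proof -
  have "r (t + of_int j * T) = r t \<and> 
      angle n H c r (t + of_int j * T) = angle n H c r t + of_int j * angle n H c r T"
  proof (induction j rule: int_induct[where k = 0])
    case (step1 i)
    then show ?case using r_period[of "t + of_int i * T"] angle_add_T[of "t + of_int i * T"] by (simp add: algebra_simps)
  next
    case (step2 i)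
    then show ?case using r_period[of "t + of_int (i - 1) * T"] angle_add_T[of "t + of_int (i - 1) * T"] by (simp add: algebra_simps)
  qed simp
  then show "r (t + of_int j * T) = r t"
    "angle n H c r (t + of_int j * T) = angle n H c r t + of_int j * angle n H c r T" by auto
qed

text \<open>
  After \<open>m\<close> periods of \<open>r\<close> the angle has advanced by \<open>2 \<pi> l\<close>, so the immersion closes up.
\<close>

lemma rot_immersion_period:
  "rot_immersion n H c r (y, t + of_int j * (of_int m * T)) = rot_immersion n H c r (y, t)"
proof -
  have "t + of_int j * (of_int m * T) = t + of_int (j * m) * T" by simp
  moreover have "of_int (j * m) * angle n H c r T = of_int (j * l) * (2 * pi)"
    using m by (simp add: closing)
  ultimately have "angle n H c r (t + of_int j * (of_int m * T)) = angle n H c r t + of_int (j * l) * (2 * pi)"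
    "r (t + of_int j * (of_int m * T)) = r t" by (simp_all only: period_shift)
  then show ?thesis
    unfolding rot_immersion_def using cos.plus_of_int[of "angle n H c r t" "j * l"]
      sin.plus_of_int[of "angle n H c r t" "j * l"] by simp
qed

lemma rot_quotient_immersion_rot_point:
  "rot_quotient_immersion n H c r (rot_point (of_int m * T) p) = rot_immersion n H c r p"
proof -
  obtain y t where p: "p = (y, t)" by (cases p)
  have "(\<lambda>t. rot_immersion n H c r (y, t)) ` (period_rel (of_int m * T) `` {t}) = {rot_immersion n H c r (y, t)}"
  proof -
    have "t \<in> period_rel (of_int m * T) `` {t}" by (auto simp: period_rel_def intro: exI[of _ 0])
    then show ?thesis by (auto simp: period_rel_def rot_immersion_period)
  qed
  then show ?thesis by (simp add: p rot_quotient_immersion_def rot_point_def)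
qed

definition circle_radius :: "real \<Rightarrow> real" where
  "circle_radius t = sqrt (1 - (r t)\<^sup>2)"

definition circle_x where "circle_x t = circle_radius t * cos (angle n H c r t)"
definition circle_y where "circle_y t = circle_radius t * sin (angle n H c r t)"

text \<open>
  With \<open>w = sqrt (1 - r\<^sup>2)\<close> the squared speed of the profile curve is
  \<open>r'\<^sup>2 + w'\<^sup>2 + w\<^sup>2 \<theta>'\<^sup>2 = (r'\<^sup>2 + r\<^sup>2 \<lambda>\<^sup>2) / (1 - r\<^sup>2)\<close>, and the equation for \<open>r\<close> makes the numerator equal to the
  denominator.
\<close>

lemma profile_curve_unit_speed:
  obtains A' B' where "(circle_x has_real_derivative A') (at t)" "(circle_y has_real_derivative B') (at t)"
    "(deriv r t)\<^sup>2 + A'\<^sup>2 + B'\<^sup>2 = 1"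
proof -
  define w where "w = circle_radius t"
  define w' where "w' = - (r t * deriv r t) / w"
  have w2: "w\<^sup>2 = 1 - (r t)\<^sup>2" using one_minus_r_sq[of t] by (simp add: w_def circle_radius_def)
  have w: "w > 0" using one_minus_r_sq[of t] by (simp add: w_def circle_radius_def)
  have "(circle_radius has_real_derivative w') (at t)"
    unfolding circle_radius_def w'_def w_def
    using one_minus_r_sq[of t] by (auto intro!: derivative_eq_intros has_derivative_r simp: divide_simps)
  then have "(circle_x has_real_derivative (w' * cos (angle n H c r t) - w * sin (angle n H c r t) * angular_speed t)) (at t)"
      "(circle_y has_real_derivative (w' * sin (angle n H c r t) + w * cos (angle n H c r t) * angular_speed t)) (at t)"
    unfolding circle_x_def circle_y_def by (auto intro!: derivative_eq_intros has_derivative_angle simp: w_def)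
  moreover have "(deriv r t)\<^sup>2 + (w' * cos (angle n H c r t) - w * sin (angle n H c r t) * angular_speed t)\<^sup>2
      + (w' * sin (angle n H c r t) + w * cos (angle n H c r t) * angular_speed t)\<^sup>2 = 1"
  proof -
    have rot: "(p * C - w * S * q)\<^sup>2 + (p * S + w * C * q)\<^sup>2 = p\<^sup>2 + w\<^sup>2 * q\<^sup>2"
      if "S\<^sup>2 + C\<^sup>2 = 1" for p q S C :: real
    proof -
      have "(p * C - w * S * q)\<^sup>2 + (p * S + w * C * q)\<^sup>2 = (p\<^sup>2 + w\<^sup>2 * q\<^sup>2) * (S\<^sup>2 + C\<^sup>2)"
        by (simp add: power2_eq_square algebra_simps)
      then show ?thesis using that by simp
    qed
    have "w\<^sup>2 * ((deriv r t)\<^sup>2 + (w'\<^sup>2 + w\<^sup>2 * (angular_speed t)\<^sup>2)) = w\<^sup>2"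
    proof -
      have "w\<^sup>2 * w'\<^sup>2 = (r t)\<^sup>2 * (deriv r t)\<^sup>2"
        using w by (simp add: w'_def power_divide power_mult_distrib)
      moreover have "w\<^sup>2 * (angular_speed t) = r t * curv n H c r t"
        using one_minus_r_sq[of t] by (simp add: angular_speed_def w2)
      then have "w\<^sup>2 * (w\<^sup>2 * (angular_speed t)\<^sup>2) = (r t)\<^sup>2 * (curv n H c r t)\<^sup>2"
        by (metis power_mult_distrib power2_eq_square mult.assoc mult.left_commute)
      ultimately have "w\<^sup>2 * ((deriv r t)\<^sup>2 + (w'\<^sup>2 + w\<^sup>2 * (angular_speed t)\<^sup>2)) =
         (1 - (r t)\<^sup>2) * (deriv r t)\<^sup>2 + (r t)\<^sup>2 * (deriv r t)\<^sup>2 + (r t)\<^sup>2 * (curv n H c r t)\<^sup>2"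
        by (simp add: distrib_left w2)
      also have "\<dots> = 1 - (r t)\<^sup>2" using profile[of t] by (simp add: algebra_simps)
      finally show ?thesis by (simp add: w2)
    qed
    then have "(deriv r t)\<^sup>2 + (w'\<^sup>2 + w\<^sup>2 * (angular_speed t)\<^sup>2) = 1" using w by simp
    then show ?thesis using rot[of "sin (angle n H c r t)" "cos (angle n H c r t)" w' "angular_speed t"] by (simp add: add.assoc)
  qed
  ultimately show thesis by (rule that)
qed

text \<open>
  The cross terms between \<open>dY\<close> and \<open>d\<tau>\<close> vanish because \<open>Y\<close> is orthogonal to its derivatives, and the
  coefficient of \<open>d\<tau>\<^sup>2\<close> is the squared speed of the profile curve.
\<close>

lemma induced_metric_warped:
  fixes Y :: "'e::euclidean_space \<Rightarrow> 'a::euclidean_space" and \<tau> :: "'e \<Rightarrow> real"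
  assumes U: "open U" "b \<in> U" and Y: "Y differentiable at b" "Y ` U \<subseteq> sphere 0 1"
    and \<tau>: "\<tau> differentiable at b"
  shows "induced_metric (\<lambda>b. rot_immersion n H c r (Y b, \<tau> b)) b v w
    = (r (\<tau> b))\<^sup>2 * (dd v Y b \<bullet> dd w Y b) + dd v \<tau> b * dd w \<tau> b"
proof -
  obtain A' B' where A': "(circle_x has_real_derivative A') (at (\<tau> b))" and B': "(circle_y has_real_derivative B') (at (\<tau> b))"
    and unit: "(deriv r (\<tau> b))\<^sup>2 + A'\<^sup>2 + B'\<^sup>2 = 1" by (rule profile_curve_unit_speed)
  have comp: "((\<lambda>b. k (\<tau> b)) has_derivative (\<lambda>v. k' * dd v \<tau> b)) (at b)"
    if "(k has_real_derivative k') (at (\<tau> b))" for k k'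
    using diff_chain_at[OF dd_works[OF \<tau>] that[unfolded has_field_derivative_def]] by (simp add: o_def)
  have "((\<lambda>b. (r (\<tau> b) *\<^sub>R Y b, circle_x (\<tau> b), circle_y (\<tau> b))) has_derivative
     (\<lambda>v. (r (\<tau> b) *\<^sub>R dd v Y b + (deriv r (\<tau> b) * dd v \<tau> b) *\<^sub>R Y b, A' * dd v \<tau> b, B' * dd v \<tau> b))) (at b)"
    by (intro has_derivative_Pair has_derivative_scaleR comp A' B' has_derivative_r dd_works Y)
  moreover have "(\<lambda>b. rot_immersion n H c r (Y b, \<tau> b)) = (\<lambda>b. (r (\<tau> b) *\<^sub>R Y b, circle_x (\<tau> b), circle_y (\<tau> b)))"
    by (simp add: rot_immersion_def circle_x_def circle_y_def circle_radius_def)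
  ultimately have d: "dd v (\<lambda>b. rot_immersion n H c r (Y b, \<tau> b)) b =
     (r (\<tau> b) *\<^sub>R dd v Y b + (deriv r (\<tau> b) * dd v \<tau> b) *\<^sub>R Y b, A' * dd v \<tau> b, B' * dd v \<tau> b)" for v
    by (simp add: dd_eq)
  have t: "Y b \<bullet> dd v Y b = 0" "dd v Y b \<bullet> Y b = 0" for v
    using sphere_tangent[OF U Y(2,1)] by (simp_all add: inner_commute)
  have YY: "Y b \<bullet> Y b = 1" using Y(2) U by (auto simp: norm_eq_1)
  have "induced_metric (\<lambda>b. rot_immersion n H c r (Y b, \<tau> b)) b v w
    = (r (\<tau> b))\<^sup>2 * (dd v Y b \<bullet> dd w Y b) + ((deriv r (\<tau> b))\<^sup>2 + A'\<^sup>2 + B'\<^sup>2) * (dd v \<tau> b * dd w \<tau> b)"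
    unfolding induced_metric_def d by (simp add: inner_add_left inner_add_right t YY power2_eq_square algebra_simps)
  then show ?thesis by (simp add: unit)
qed

end

section \<open>The Laplacian of the rotational hypersurface\<close>

lemma deriv_periodic:
  fixes p :: "real \<Rightarrow> real"
  assumes "\<And>s. p (s + d) = p s"
  shows "deriv p (s + d) = deriv p s"
proof -
  have "(p has_real_derivative D) (at (s + d)) \<longleftrightarrow> (p has_real_derivative D) (at s)" for D
    using DERIV_shift[of p D s d] assms by simp
  then show ?thesis by (simp add: deriv_def)
qed

lemma rot_point_eqD:
  assumes "rot_point P (y', t') = rot_point P (y, t)"
  shows "y' = y" "\<exists>j::int. t' = t + of_int j * P"
proof -
  have "t' \<in> period_rel P `` {t'}" by (auto simp: period_rel_def intro: exI[of _ 0])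
  then show "y' = y" "\<exists>j::int. t' = t + of_int j * P"
    using assms by (auto simp: rot_point_def period_rel_def)
qed

text \<open>
  Two points of a strip of width \<open>P\<close> never differ by a nonzero multiple of \<open>P\<close>.
\<close>

lemma inj_on_rot_point_strip:
  assumes "inj_on x U" "P > 0" "\<And>b. b \<in> U \<Longrightarrow> \<bar>snd (x b) - t\<bar> < P / 2"
  shows "inj_on (rot_point P \<circ> x) U"
proof (rule inj_onI)
  fix b b' assume b: "b \<in> U" "b' \<in> U" and eq: "(rot_point P \<circ> x) b = (rot_point P \<circ> x) b'"
  have "rot_point P (fst (x b), snd (x b)) = rot_point P (fst (x b'), snd (x b'))" using eq by simp
  from rot_point_eqD[OF this] obtain j :: int
    where f: "fst (x b) = fst (x b')" and j: "snd (x b) = snd (x b') + of_int j * P" by blast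
  have "\<bar>of_int j * P\<bar> < P"
    using assms(3)[OF b(1)] assms(3)[OF b(2)] unfolding j by linarith
  then have "\<bar>real_of_int j\<bar> < 1" using assms(2) by (simp add: abs_mult)
  then have "j = 0" by linarith
  then have "x b = x b'" using f j by (simp add: prod_eq_iff)
  then show "b = b'" using assms(1) b by (simp add: inj_onD)
qed

text \<open>
  A chart of the quotient comes from a chart of the cylinder that passes through \<open>(y, t + j m T)\<close> for
  some integer \<open>j\<close>; periodicity of \<open>r\<close>, of \<open>gbar\<close> and of their derivatives moves the values back to \<open>t\<close>.
  Around that point the chart is restricted to the hemisphere on which \<open>graph\<close> and \<open>proj\<close> are inverse
  to each other.
\<close>

lemma (in rotational_profile) laplacian_in_rot_chart:
  fixes fbar :: "real ^ 'n \<Rightarrow> real" and \<iota> :: "real ^ 'k \<Rightarrow> real ^ 'n"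
    and f g :: "(real ^ 'n) \<times> real set \<Rightarrow> real"
  assumes frame: "tangent_frame y \<iota>" and dim: "CARD('n) = CARD('k) + 1"
    and fbar: "smooth_function (submanifold_atlas TYPE(real ^ 'k) (sphere 0 1)) fbar"
    and gbar: "smooth_on UNIV gbar" "\<And>s. gbar (s + of_int m * T) = gbar s"
    and fg: "\<And>y t. y \<in> sphere 0 1 \<Longrightarrow> f (rot_point (of_int m * T) (y, t)) = fbar y"
      "\<And>y t. y \<in> sphere 0 1 \<Longrightarrow> g (rot_point (of_int m * T) (y, t)) = gbar t"
    and chart: "(U, X) \<in> rot_atlas (of_int m * T)" and a: "a \<in> U" "X a = rot_point (of_int m * T) (y, t)"
  shows "metric_laplacian (induced_metric (rot_quotient_immersion n H c r \<circ> X)) ((\<lambda>q. f q * g q) \<circ> X) a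
    = fbar y * (deriv (deriv gbar) t + real CARD('k) * (deriv r t / r t) * deriv gbar t)
      + (\<Sum>i\<in>Basis. dd i (dd i (fbar \<circ> tangent_frame.graph y \<iota>)) 0) / (r t)\<^sup>2 * gbar t"
proof -
  interpret tangent_frame y \<iota> by fact
  define P where "P = of_int m * T"
  obtain x where X: "X = rot_point P \<circ> x" and x: "(U, x) \<in> submanifold_atlas TYPE(real ^ 'n) (sphere 0 1 \<times> UNIV)"
    using chart by (auto simp: rot_atlas_def P_def)
  have U: "open U" and sx: "smooth_on U x" and imm: "\<And>b. b \<in> U \<Longrightarrow> inj (frechet_derivative x (at b))"
    and S: "x ` U \<subseteq> sphere 0 1 \<times> UNIV"
    using x by (auto simp: submanifold_atlas_def dest: openin_imp_subset)
  define Y \<tau> where "Y = (\<lambda>b. fst (x b))" and "\<tau> = (\<lambda>b. snd (x b))"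
  have YU: "higher_differentiable_on U Y k" and \<tau>U: "higher_differentiable_on U \<tau> k" for k
    unfolding Y_def \<tau>_def
    by (rule higher_diff_linear_compose[OF bounded_linear_fst U smooth_onD[OF sx]],
        rule higher_diff_linear_compose[OF bounded_linear_snd U smooth_onD[OF sx]])
  have xY: "x b = (Y b, \<tau> b)" for b by (simp add: Y_def \<tau>_def)
  have SY: "Y b \<in> sphere 0 1" if "b \<in> U" for b using S that xY by auto
  obtain j :: int where Ya: "Y a = y" and j: "\<tau> a = t + of_int j * P"
    using rot_point_eqD[of P "Y a" "\<tau> a" y t] a(2) by (auto simp: X P_def xY)
  have shift: "p (s + of_int j * P) = p s" if "\<And>s. p (s + P) = p s" for p :: "real \<Rightarrow> real" and s
  proof -
    interpret periodic_fun_simple p P by unfold_locales (rule that)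
    show ?thesis by (rule plus_of_int)
  qed
  have r_shift: "r (s + of_int j * P) = r s" for s
    using period_shift(1)[of s "j * m"] by (simp add: P_def mult.assoc)
  have g_shift: "gbar (s + of_int j * P) = gbar s" for s
    by (rule shift) (simp add: P_def gbar)
  note g1_shift = deriv_periodic[of gbar, OF g_shift]
  note at_a = r_shift[of t, folded j] deriv_periodic[of r, OF r_shift, of t, folded j]
    g_shift[of t, folded j] g1_shift[of t, folded j] deriv_periodic[of "deriv gbar", OF g1_shift, of t, folded j]
  have h: "higher_differentiable_on (ball 0 1) (fbar \<circ> graph) 2"
    using fbar graph_chart by (auto simp: smooth_function_def smooth_on_def)
  define U' where "U' = U \<inter> Y -` {q. y \<bullet> q > 0}"
  have U': "open U'"
    unfolding U'_def using YU[of 0] continuous_open_preimage[OF _ U open_hemisphere] by simp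
  have sub: "U' \<subseteq> U" by (auto simp: U'_def)
  have gp: "norm (proj (Y b)) < 1" "graph (proj (Y b)) = Y b" if "b \<in> U'" for b
    using that SY[of b] graph_proj[of "Y b"] by (auto simp: U'_def)
  have F: "rot_quotient_immersion n H c r \<circ> X = (\<lambda>b. rot_immersion n H c r (Y b, \<tau> b))"
    by (rule ext) (simp add: X P_def rot_quotient_immersion_rot_point xY)
  have "metric_laplacian (induced_metric (rot_quotient_immersion n H c r \<circ> X)) ((\<lambda>q. f q * g q) \<circ> X) a =
    (fbar \<circ> graph) 0 * (deriv (deriv gbar) (\<tau> a) + real CARD('k) * (deriv r (\<tau> a) / r (\<tau> a)) * deriv gbar (\<tau> a))
    + (\<Sum>i\<in>Basis. dd i (dd i (fbar \<circ> graph)) 0) / (r (\<tau> a))\<^sup>2 * gbar (\<tau> a)"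
  proof (rule warped_laplacian_graph_chart[where U = U' and Y = Y and \<tau> = \<tau> and r = r and g = gbar
        and V = "ball 0 1" and h = "fbar \<circ> graph"])
    show "CARD('n) = CARD('k) + 1" "open U'" "Y a = y" "open (ball (0 :: real ^ 'k) 1)"
      by (simp_all add: dim U' Ya)
    show "higher_differentiable_on (ball 0 1) (fbar \<circ> graph) 2" "higher_differentiable_on UNIV gbar 2"
      by (rule h, rule smooth_onD[OF gbar(1)])
    show "r differentiable at s" "0 < r s" for s by (rule r_differentiable, rule r_bounds)
    show "a \<in> U'" using a by (simp add: U'_def Ya y_inner)
    show "higher_differentiable_on U' Y 2" "higher_differentiable_on U' \<tau> 2"
      by (rule higher_diff_mono_on[OF YU sub], rule higher_diff_mono_on[OF \<tau>U sub])
    show "Y ` U' \<subseteq> sphere 0 1" using SY sub by blast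
    show "(\<lambda>b. proj (Y b)) ` U' \<subseteq> ball 0 1" using gp by auto
  next
    fix b assume b: "b \<in> U'"
    have xb: "x differentiable at b" using smooth_onD[OF sx, of "Suc 0"] b sub by auto
    have "(\<lambda>v. (dd v Y b, dd v \<tau> b)) = frechet_derivative x (at b)"
      unfolding Y_def \<tau>_def
      by (simp add: dd_linear_compose(1)[OF bounded_linear_fst xb] dd_linear_compose(1)[OF bounded_linear_snd xb])
    then show "inj (\<lambda>v. (dd v Y b, dd v \<tau> b))" using imm b sub by auto
    show "induced_metric (rot_quotient_immersion n H c r \<circ> X) b v w =
        (r (\<tau> b))\<^sup>2 * (dd v Y b \<bullet> dd w Y b) + dd v \<tau> b * dd w \<tau> b" for v w
      unfolding F
      by (rule induced_metric_warped[OF U]) (use b sub SY YU[of "Suc 0"] \<tau>U[of "Suc 0"] in auto)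
    show "((\<lambda>q. f q * g q) \<circ> X) b = (fbar \<circ> graph) (proj (Y b)) * gbar (\<tau> b)"
      using fg[of "Y b" "\<tau> b"] SY[of b] b sub gp(2)[OF b] by (auto simp: X P_def xY)
  qed
  then show ?thesis by (simp add: at_a graph_0)
qed

theorem theorem3p1:
  fixes n :: nat and H c T :: real and r :: "real \<Rightarrow> real" and l m :: int
    and fbar :: "real ^ 'n \<Rightarrow> real" and gbar :: "real \<Rightarrow> real"
    and f g :: "(real ^ 'n) \<times> real set \<Rightarrow> real"
  assumes "n \<ge> 2" and "CARD('n) = n" and "CARD('k) = n - 1"
    and "c > 0"
    and "smooth_on UNIV r"
    and "\<forall>t. 0 < r t \<and> r t < 1"
    and "\<not> r constant_on UNIV"
    and "least_period r T"
    and "\<forall>t. (deriv r t)\<^sup>2 + (r t)\<^sup>2 * (1 + (curv n H c r t)\<^sup>2) = 1"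
    and "coprime l m" and "m \<ge> 1"
    and "angle n H c r T = 2 * pi * (of_int l / of_int m)"
    and "smooth_function (submanifold_atlas TYPE(real ^ 'k) (sphere (0 :: real ^ 'n) 1)) fbar"
    and "smooth_on UNIV gbar"
    and "\<forall>t. gbar (t + of_int m * T) = gbar t"
    and "\<forall>y \<in> sphere 0 1. \<forall>t. f (rot_point (of_int m * T) (y, t)) = fbar y"
    and "\<forall>y \<in> sphere 0 1. \<forall>t. g (rot_point (of_int m * T) (y, t)) = gbar t"
  shows "\<forall>y \<in> sphere 0 1. \<forall>t.
    (let p = rot_point (of_int m * T) (y, t) in
      laplacian (rot_atlas (of_int m * T)) (rot_quotient_immersion n H c r) (\<lambda>q. f q * g q) p
      = f p * (deriv (deriv gbar) t + (real n - 1) * (deriv r t / r t) * deriv gbar t)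
        + laplacian (submanifold_atlas TYPE(real ^ 'k) (sphere (0 :: real ^ 'n) 1)) id fbar y
            / (r t)\<^sup>2 * g p)"
proof (intro ballI allI)
  fix y :: "real ^ 'n" and t :: real
  assume y: "y \<in> sphere 0 1"
  have T: "T > 0" "\<And>t. r (t + T) = r t" using assms(8) by (auto simp: least_period_def)
  interpret rotational_profile n H c T r l m
    by unfold_locales (use assms(5,6,9,11,12) T in auto)
  have dims: "CARD('n) = CARD('k) + 1" "CARD('k) = CARD('n) - 1" "real n - 1 = real CARD('k)"
    using assms(1-3) by auto
  obtain \<iota> :: "real ^ 'k \<Rightarrow> real ^ 'n" where frame: "tangent_frame y \<iota>"
    by (rule ex_tangent_frame[of y]) (use y dims in auto)
  interpret tangent_frame y \<iota> by fact
  define P where "P = of_int m * T"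
  have P: "P > 0" using T assms(11) by (simp add: P_def)
  define L where "L = fbar y * (deriv (deriv gbar) t + real CARD('k) * (deriv r t / r t) * deriv gbar t)
      + (\<Sum>i\<in>Basis. dd i (dd i (fbar \<circ> graph)) 0) / (r t)\<^sup>2 * gbar t"
  have val: "metric_laplacian (induced_metric (rot_quotient_immersion n H c r \<circ> X)) ((\<lambda>q. f q * g q) \<circ> X) a = L"
    if "(U, X) \<in> rot_atlas P" "a \<in> U" "X a = rot_point P (y, t)" for U X a
    unfolding L_def
    by (rule laplacian_in_rot_chart[OF frame dims(1) assms(13,14)]) (use assms(15-17) that in \<open>auto simp: P_def\<close>)
  \<comment> \<open>With half-width \<open>P / 2\<close> the chart of the cylinder stays injective on the quotient.\<close>
  obtain U x a where x: "(U, x) \<in> submanifold_atlas TYPE(real ^ 'n) (sphere 0 1 \<times> UNIV)"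
    and a: "a \<in> U" "x a = (y, t)" and strip: "\<And>b. b \<in> U \<Longrightarrow> \<bar>snd (x b) - t\<bar> < P / 2"
    using graph_cylinder_chart[OF dims(1), of "P / 2" t] P by auto
  have "inj_on x U" using x by (auto simp: submanifold_atlas_def homeomorphism_def intro: inj_on_inverseI)
  then have "inj_on (rot_point P \<circ> x) U" by (rule inj_on_rot_point_strip[OF _ P strip])
  then have chart: "(U, rot_point P \<circ> x) \<in> rot_atlas P"
    using x unfolding rot_atlas_def by blast
  have "laplacian (rot_atlas P) (rot_quotient_immersion n H c r) (\<lambda>q. f q * g q) (rot_point P (y, t)) = L"
    unfolding laplacian_def
  proof (rule the_equality)
    show "\<forall>(U, X)\<in>rot_atlas P. \<forall>a\<in>U. X a = rot_point P (y, t) \<longrightarrow>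
      metric_laplacian (induced_metric (rot_quotient_immersion n H c r \<circ> X)) ((\<lambda>q. f q * g q) \<circ> X) a = L"
      using val by blast
    fix L' assume "\<forall>(U, X)\<in>rot_atlas P. \<forall>a\<in>U. X a = rot_point P (y, t) \<longrightarrow>
      metric_laplacian (induced_metric (rot_quotient_immersion n H c r \<circ> X)) ((\<lambda>q. f q * g q) \<circ> X) a = L'"
    from bspec[OF this chart] a
    have "metric_laplacian (induced_metric (rot_quotient_immersion n H c r \<circ> (rot_point P \<circ> x)))
        ((\<lambda>q. f q * g q) \<circ> (rot_point P \<circ> x)) a = L'" by simp
    then show "L' = L" using val[OF chart a(1)] a(2) by simp
  qed
  then show "let p = rot_point (of_int m * T) (y, t) in
      laplacian (rot_atlas (of_int m * T)) (rot_quotient_immersion n H c r) (\<lambda>q. f q * g q) p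
      = f p * (deriv (deriv gbar) t + (real n - 1) * (deriv r t / r t) * deriv gbar t)
        + laplacian (submanifold_atlas TYPE(real ^ 'k) (sphere (0 :: real ^ 'n) 1)) id fbar y
            / (r t)\<^sup>2 * g p"
    using assms(16,17) y
    by (simp add: L_def P_def dims(3) sphere_laplacian_via_graph[OF frame assms(13)])
qed

end
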